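(* Let $G$ be a finite chordal graph such that the independence complex $\mathrm{Ind}(G)$ is homotopy equivalent to the sphere $S^{k-1}$ for some integer $k\geq 1$. Then the core of $\mathrm{Ind}(G)$ is isomorphic to $\mathrm{Ind}(M_k)$, the boundary complex of the $k$-dimensional cross-polytope.
   Context: A graph is chordal if it has no induced cycle of length more than three. $\mathrm{Ind}(G)$ is the simplicial complex on $V(G)$ whose faces are the independent sets of $G$. For a simplicial complex $K$, a vertex $u$ is dominated by a vertex $u'\neq u$ if the link $\mathrm{lk}_K(u)$ is a cone with apex $u'$; removing a dominated vertex is an elementary dismantling. The core of $K$ is the complex obtained by performing elementary dismantlings until no dominated vertex remains; it is well defined up to isomorphism independently of the choices made. $M_k$ denotes the matching with $k$ edges, i.e. the graph on $2k$ vertices each of whose connected components is a single edge. *)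

theory Defs
  imports "HOL-Analysis.Analysis" "Graph_Theory.Pair_Digraph"
begin

text \<open>
  A finite simple graph is a \<open>pair_graph\<close>: a finite, loop-free, symmetric digraph without parallel
  arcs.  An undirected edge \<open>uv\<close> is the pair of arcs \<open>(u,v)\<close>, \<open>(v,u)\<close>.
\<close>

section \<open>Chordal graphs\<close>

text \<open>
  The vertices of an induced cycle are listed in cyclic order; the equivalence says that the only
  edges of \<open>G\<close> among them are the edges of the cycle.
\<close>

definition induced_cycle :: "'a pair_pre_digraph \<Rightarrow> 'a list \<Rightarrow> bool" where
  "induced_cycle G vs \<longleftrightarrow>
     length vs \<ge> 3 \<and> distinct vs \<and> set vs \<subseteq> pverts G \<and>
     (\<forall>i < length vs. \<forall>j < length vs.
        (vs ! i, vs ! j) \<in> parcs G \<longleftrightarrow>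
          j = Suc i mod length vs \<or> i = Suc j mod length vs)"

definition chordal :: "'a pair_pre_digraph \<Rightarrow> bool" where
  "chordal G \<longleftrightarrow> \<not> (\<exists>vs. induced_cycle G vs \<and> length vs > 3)"

section \<open>Abstract simplicial complexes\<close>

text \<open>
  A complex is the set of its faces and always has the empty face.  Its vertices are the
  elements of its faces, so the vertex set of \<open>K\<close> is \<open>\<Union>K\<close>.
\<close>

definition abstract_complex :: "'a set set \<Rightarrow> bool" where
  "abstract_complex K \<longleftrightarrow>
     {} \<in> K \<and> (\<forall>\<sigma>\<in>K. finite \<sigma>) \<and> (\<forall>\<sigma>\<in>K. \<forall>\<tau>. \<tau> \<subseteq> \<sigma> \<longrightarrow> \<tau> \<in> K)"

definition complex_iso :: "'a set set \<Rightarrow> 'b set set \<Rightarrow> bool"  (infix "\<cong>\<^sub>c" 50) where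
  "K \<cong>\<^sub>c L \<longleftrightarrow>
     (\<exists>f. bij_betw f (\<Union>K) (\<Union>L) \<and> (\<forall>\<sigma>. \<sigma> \<subseteq> \<Union>K \<longrightarrow> (\<sigma> \<in> K \<longleftrightarrow> f ` \<sigma> \<in> L)))"

text \<open>
  Points of the geometric realization are barycentric coordinates, extended by \<open>0\<close> outside the
  vertex set.  The topology is that of pointwise convergence; for finite complexes, the only ones
  it is used for here, this is the usual topology of the polyhedron.
\<close>

definition geometric_realization :: "'a set set \<Rightarrow> ('a \<Rightarrow> real) topology" where
  "geometric_realization K =
     subtopology (powertop_real UNIV)
       {x. (\<forall>v. x v \<ge> 0) \<and> {v. x v \<noteq> 0} \<in> K \<and> (\<Sum>v | x v \<noteq> 0. x v) = 1}"

definition link :: "'a set set \<Rightarrow> 'a \<Rightarrow> 'a set set" where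
  "link K u = {\<sigma> \<in> K. u \<notin> \<sigma> \<and> insert u \<sigma> \<in> K}"

text \<open>
  The base may be the complex \<open>{{}}\<close> without vertices, whose cone is a single point; the complex
  \<open>{{}}\<close> itself is not a cone.
\<close>

definition cone_with_apex :: "'a set set \<Rightarrow> 'a \<Rightarrow> bool" where
  "cone_with_apex L a \<longleftrightarrow>
     (\<exists>B. abstract_complex B \<and> a \<notin> \<Union>B \<and> L = B \<union> insert a ` B)"

section \<open>Dismantlings and cores\<close>

definition dominated_by :: "'a set set \<Rightarrow> 'a \<Rightarrow> 'a \<Rightarrow> bool" where
  "dominated_by K u u' \<longleftrightarrow>
     u \<in> \<Union>K \<and> u' \<in> \<Union>K \<and> u' \<noteq> u \<and> cone_with_apex (link K u) u'"

definition dominated :: "'a set set \<Rightarrow> 'a \<Rightarrow> bool" where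
  "dominated K u \<longleftrightarrow> (\<exists>u'. dominated_by K u u')"

definition remove_vertex :: "'a set set \<Rightarrow> 'a \<Rightarrow> 'a set set" where
  "remove_vertex K u = {\<sigma> \<in> K. u \<notin> \<sigma>}"

definition elementary_dismantling :: "'a set set \<Rightarrow> 'a set set \<Rightarrow> bool" where
  "elementary_dismantling K L \<longleftrightarrow> (\<exists>u. dominated K u \<and> L = remove_vertex K u)"

text \<open>
  A complex may have several cores, one for each way of choosing the dominated vertices; they are
  all isomorphic.  Hence the core is a relation between complexes rather than a function.
\<close>

definition is_core_of :: "'a set set \<Rightarrow> 'a set set \<Rightarrow> bool" where
  "is_core_of C K \<longleftrightarrow> elementary_dismantling\<^sup>*\<^sup>* K C \<and> (\<forall>u. \<not> dominated C u)"

lemma finite_complex_has_core: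
  assumes "finite K"
  shows "\<exists>C. is_core_of C K"
  using assms
proof (induction K rule: finite_psubset_induct)
  case (psubset K)
  show ?case
  proof (cases "\<exists>u. dominated K u")
    case False
    then show ?thesis unfolding is_core_of_def by blast
  next
    case True
    then obtain u where u: "dominated K u" by blast
    then have "remove_vertex K u \<subset> K"
      unfolding dominated_def dominated_by_def remove_vertex_def by auto
    with psubset obtain C where "is_core_of C (remove_vertex K u)" by blast
    moreover have "elementary_dismantling K (remove_vertex K u)"
      using u unfolding elementary_dismantling_def by blast
    ultimately show ?thesis
      unfolding is_core_of_def by (meson converse_rtranclp_into_rtranclp)
  qed
qed

section \<open>Independence complexes and matchings\<close>

definition independence_complex :: "'a pair_pre_digraph \<Rightarrow> 'a set set" where
  "independence_complex G =
     {\<sigma>. \<sigma> \<subseteq> pverts G \<and> (\<forall>u\<in>\<sigma>. \<forall>v\<in>\<sigma>. (u, v) \<notin> parcs G)}"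

lemma (in pair_graph) independence_complex:
  "abstract_complex (independence_complex G)" "\<Union>(independence_complex G) = pverts G"
  "finite (independence_complex G)"
proof -
  show "abstract_complex (independence_complex G)"
    unfolding abstract_complex_def independence_complex_def
    using pair_finite_verts finite_subset by blast
  have "{v} \<in> independence_complex G" if "v \<in> pverts G" for v
    using that no_loops' unfolding independence_complex_def by auto
  moreover have sub: "independence_complex G \<subseteq> Pow (pverts G)"
    unfolding independence_complex_def by auto
  ultimately show "\<Union>(independence_complex G) = pverts G"
    by (intro subset_antisym Union_least subsetI) auto
  from sub show "finite (independence_complex G)"
    by (rule finite_subset) (simp add: pair_finite_verts)
qed

text \<open>The matching with \<open>k\<close> edges; the \<open>i\<close>-th edge joins \<open>(i, False)\<close> and \<open>(i, True)\<close>.\<close>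

definition matching_graph :: "nat \<Rightarrow> (nat \<times> bool) pair_pre_digraph" where
  "matching_graph k =
     \<lparr> pverts = {..<k} \<times> UNIV,
       parcs = {((i, a), (j, b)) | i j a b. i < k \<and> i = j \<and> a \<noteq> b} \<rparr>"

lemma pair_graph_matching_graph: "pair_graph (matching_graph k)"
proof unfold_locales
  have "sym (parcs (matching_graph k))"
    by (rule symI) (auto simp: matching_graph_def)
  then show "symmetric (with_proj (matching_graph k))"
    by (simp add: symmetric_def)
  show "finite (parcs (matching_graph k))"
    by (rule finite_subset[of _ "({..<k} \<times> UNIV) \<times> ({..<k} \<times> UNIV)"])
      (auto simp: matching_graph_def)
  show "finite (pverts (matching_graph k))"
    by (simp add: matching_graph_def)
  fix e assume "e \<in> parcs (matching_graph k)"
  then show "fst e \<in> pverts (matching_graph k)" "snd e \<in> pverts (matching_graph k)"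
    "fst e \<noteq> snd e"
    by (auto simp: matching_graph_def)
qed

section \<open>The boundary complex of the cross-polytope\<close>

definition cross_polytope_vertices :: "'a::euclidean_space set" where
  "cross_polytope_vertices = Basis \<union> uminus ` Basis"

definition cross_polytope :: "'a::euclidean_space set" where
  "cross_polytope = convex hull cross_polytope_vertices"

text \<open>The boundary complex consists of the vertex sets of the proper faces of the polytope.\<close>

definition cross_polytope_boundary :: "'a::euclidean_space set set" where
  "cross_polytope_boundary =
     {F \<inter> cross_polytope_vertices | F. F face_of cross_polytope \<and> F \<noteq> cross_polytope}"

lemma Basis_neq_uminus_Basis:
  fixes b d :: "'a::euclidean_space"
  assumes "b \<in> Basis" "d \<in> Basis"
  shows "b \<noteq> - d"
proof
  assume "b = - d"
  then have "b \<bullet> b = - (d \<bullet> b)" by (metis inner_minus_left)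
  then show False using assms by (simp add: inner_Basis split: if_splits)
qed

lemma cross_polytope_vertices_neq_uminus:
  assumes "v \<in> cross_polytope_vertices"
  shows "- v \<noteq> v"
proof -
  consider "v \<in> Basis" | "- v \<in> Basis"
    using assms by (auto simp: cross_polytope_vertices_def)
  then show ?thesis
    by cases (metis Basis_neq_uminus_Basis minus_minus)+
qed

lemma cross_polytope_boundary_eq:
  "(cross_polytope_boundary :: 'a::euclidean_space set set) =
     {\<sigma>. \<sigma> \<subseteq> cross_polytope_vertices \<and> (\<forall>v\<in>\<sigma>. - v \<notin> \<sigma>)}"
proof (intro set_eqI iffI)
  let ?V = "cross_polytope_vertices :: 'a set" and ?P = "cross_polytope :: 'a set"
  have V: "v \<in> ?P" "- v \<in> ?V" "v \<noteq> 0" if "v \<in> ?V" for v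
    using that unfolding cross_polytope_def cross_polytope_vertices_def
    by (auto simp: hull_inc)
  have zero: "0 \<in> open_segment v (- v)" if "v \<in> ?V" for v :: 'a
    using cross_polytope_vertices_neq_uminus[OF that] midpoint_in_open_segment[of v "- v"]
    by (simp add: midpoint_def eq_commute)
  {
    fix \<sigma> assume "\<sigma> \<in> (cross_polytope_boundary :: 'a set set)"
    then obtain F where F: "\<sigma> = F \<inter> ?V" "F face_of ?P" "F \<noteq> ?P"
      unfolding cross_polytope_boundary_def by blast
    have "- v \<notin> \<sigma>" if v: "v \<in> \<sigma>" for v
    proof
      assume "- v \<in> \<sigma>"
      with v F have "open_segment v (- v) \<subseteq> F"
        by (metis IntD1 convex_contains_open_segment face_of_imp_convex)
      with zero v F have "0 \<in> F" by blast
      then have "w \<in> F" if "w \<in> ?V" for w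
        using F(2) V[OF that] V(1)[OF V(2)[OF that]] zero[OF that]
        unfolding face_of_def by blast
      then have "?P \<subseteq> F"
        unfolding cross_polytope_def using face_of_imp_convex[OF F(2)]
        by (intro hull_minimal) auto
      with F face_of_imp_subset show False by blast
    qed
    with F show "\<sigma> \<in> {\<sigma>. \<sigma> \<subseteq> ?V \<and> (\<forall>v\<in>\<sigma>. - v \<notin> \<sigma>)}" by blast
  next
    fix \<sigma> assume "\<sigma> \<in> {\<sigma>. \<sigma> \<subseteq> ?V \<and> (\<forall>v\<in>\<sigma>. - v \<notin> \<sigma>)}"
    then have \<sigma>: "\<sigma> \<subseteq> ?V" "\<And>v. v \<in> \<sigma> \<Longrightarrow> - v \<notin> \<sigma>" by auto
    have fin: "finite \<sigma>"
      by (rule finite_subset[OF \<sigma>(1)]) (simp add: cross_polytope_vertices_def)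
    define c where "c = \<Sum>\<sigma>"
    have inner: "v \<bullet> w = (if v = w then 1 else if v = - w then - 1 else 0)"
      if "v \<in> ?V" "w \<in> ?V" for v w
    proof -
      have "b \<noteq> - d" if "b \<in> Basis" "d \<in> Basis" for b d :: 'a
        using that by (rule Basis_neq_uminus_Basis)
      then show ?thesis
        using that by (fastforce simp: cross_polytope_vertices_def inner_Basis)
    qed
    have c: "c \<bullet> w = (if w \<in> \<sigma> then 1 else if - w \<in> \<sigma> then - 1 else 0)" if w: "w \<in> ?V" for w
    proof -
      have "w \<noteq> - w"
        using cross_polytope_vertices_neq_uminus[OF w] by metis
      then have "c \<bullet> w = (\<Sum>v\<in>\<sigma>. (if v = w then 1 else 0) + (if v = - w then - 1 else 0))"
        unfolding c_def inner_sum_left using \<sigma>(1) w by (intro sum.cong) (auto simp: inner)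
      also have "\<dots> = (if w \<in> \<sigma> then 1 else 0) + (if - w \<in> \<sigma> then - 1 else 0)"
        using fin by (simp add: sum.distrib)
      finally show ?thesis using \<sigma>(2) by auto
    qed
    define F where "F = ?P \<inter> {x. c \<bullet> x = 1}"
    have "?P \<subseteq> {x. c \<bullet> x \<le> 1}"
      unfolding cross_polytope_def
      by (rule hull_minimal) (auto simp: c convex_halfspace_le)
    then have "F face_of ?P"
      unfolding F_def cross_polytope_def
      by (intro face_of_Int_supporting_hyperplane_le) (auto simp: convex_convex_hull)
    moreover have "F \<noteq> ?P"
    proof -
      obtain b :: 'a where "b \<in> Basis" using nonempty_Basis by blast
      then have b: "b \<in> ?V" by (simp add: cross_polytope_vertices_def)
      have "open_segment b (- b) \<subseteq> ?P"
        using V(1)[OF b] V(1)[OF V(2)[OF b]] convex_convex_hull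
        by (metis convex_contains_open_segment cross_polytope_def)
      with zero[OF b] have "0 \<in> ?P" by blast
      moreover have "0 \<notin> F" by (simp add: F_def)
      ultimately show ?thesis by metis
    qed
    moreover have "\<sigma> = F \<inter> ?V"
      using \<sigma>(1) V(1) c unfolding F_def by (auto split: if_splits)
    ultimately show "\<sigma> \<in> cross_polytope_boundary"
      unfolding cross_polytope_boundary_def by blast
  }
qed

theorem matching_iso_cross_polytope_boundary:
  "independence_complex (matching_graph DIM('a::euclidean_space)) \<cong>\<^sub>c
     (cross_polytope_boundary :: 'a set set)"
proof -
  let ?n = "DIM('a)" and ?V = "cross_polytope_vertices :: 'a set"
  let ?G = "matching_graph ?n"
  have neq: "b \<noteq> - d" if "b \<in> Basis" "d \<in> Basis" for b d :: 'a
    using that by (rule Basis_neq_uminus_Basis)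
  obtain e :: "nat \<Rightarrow> 'a" where e: "bij_betw e {..<?n} Basis"
    using ex_bij_betw_nat_finite[OF finite_Basis] by (auto simp: atLeast0LessThan)
  then have eB: "e i \<in> Basis" if "i < ?n" for i
    using that by (auto simp: bij_betw_def)
  have einj: "e i = e j \<longleftrightarrow> i = j" if "i < ?n" "j < ?n" for i j
    using e that by (auto simp: bij_betw_def inj_on_def)
  define f where "f = (\<lambda>(i, s). if s then - e i else e i)"
  have V: "pverts ?G = {..<?n} \<times> UNIV"
    by (simp add: matching_graph_def)
  have inj: "inj_on f (pverts ?G)"
    unfolding V by (auto simp: inj_on_def f_def einj eB neq neq[symmetric])
  have im: "f ` pverts ?G = ?V"
  proof -
    have "f ` pverts ?G = e ` {..<?n} \<union> (\<lambda>i. - e i) ` {..<?n}"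
      unfolding V f_def by (force simp: image_iff)
    also have "\<dots> = ?V"
      using e by (auto simp: bij_betw_def cross_polytope_vertices_def image_image[symmetric])
    finally show ?thesis .
  qed
  have adj: "(u, v) \<in> parcs ?G \<longleftrightarrow> f v = - f u" if "u \<in> pverts ?G" "v \<in> pverts ?G" for u v
    using that unfolding V
    by (auto simp: f_def matching_graph_def einj eB neq neq[symmetric] split: if_splits)
  have UV: "\<Union>(cross_polytope_boundary :: 'a set set) = ?V"
  proof -
    have "{v} \<in> cross_polytope_boundary" if "v \<in> ?V" for v
      using that cross_polytope_vertices_neq_uminus[OF that]
      by (simp add: cross_polytope_boundary_eq)
    moreover have "\<sigma> \<subseteq> ?V" if "\<sigma> \<in> cross_polytope_boundary" for \<sigma>
      using that unfolding cross_polytope_boundary_def by blast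
    ultimately show ?thesis by (intro subset_antisym Union_least subsetI) blast+
  qed
  have "\<sigma> \<in> independence_complex ?G \<longleftrightarrow> f ` \<sigma> \<in> cross_polytope_boundary"
    if "\<sigma> \<subseteq> pverts ?G" for \<sigma>
  proof -
    have "f ` \<sigma> \<subseteq> ?V" using that im by blast
    moreover have "(\<forall>u\<in>\<sigma>. \<forall>v\<in>\<sigma>. (u, v) \<notin> parcs ?G) \<longleftrightarrow> (\<forall>u\<in>\<sigma>. \<forall>v\<in>\<sigma>. - f u \<noteq> f v)"
    proof (intro ball_cong refl)
      fix u v assume "u \<in> \<sigma>" "v \<in> \<sigma>"
      with that have "u \<in> pverts ?G" "v \<in> pverts ?G" by blast+
      then show "(u, v) \<notin> parcs ?G \<longleftrightarrow> - f u \<noteq> f v"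
        using adj[of u v] by metis
    qed
    moreover have "\<dots> \<longleftrightarrow> (\<forall>x\<in>f ` \<sigma>. - x \<notin> f ` \<sigma>)"
      by blast
    ultimately show ?thesis
      using that by (simp add: independence_complex_def cross_polytope_boundary_eq)
  qed
  then show ?thesis
    unfolding complex_iso_def UV pair_graph.independence_complex(2)[OF pair_graph_matching_graph]
    using inj im by (intro exI[of _ f]) (auto simp: bij_betw_def)
qed

end

theory Submission
  imports Defs "HOL-Homology.Homology"
begin

text \<open>
  Dismantling \<open>Ind(G)\<close> means deleting vertices \<open>v\<close> with \<open>N(u) \<subseteq> N(v)\<close> for some \<open>u\<close>, so the core is
  \<open>Ind(H)\<close> for an induced subgraph \<open>H\<close> without such pairs, and \<open>H\<close> is again chordal.

  Suppose that a maximal independent set \<open>F\<close> of \<open>H\<close> extends to an induced matching that pairs each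
  vertex of \<open>F\<close> with a partner outside \<open>F\<close>.  The matching spans a cross-polytope in \<open>Ind(H)\<close>, and
  collapsing everything but the open facet \<open>F\<close> maps \<open>Ind(H)\<close> to a sphere so that the composition has
  degree one.  If \<open>Ind(H) \<simeq> S\<^sup>n\<close>, then \<open>F\<close> has \<open>n + 1\<close> elements; for two such sets, multiplicativity of
  the degree makes the cross-polytope of the second hit the facet of the first, so the matching of
  the second covers the first set.

  For a simplicial vertex \<open>z\<close> of \<open>H\<close> and each neighbour \<open>t\<close> of \<open>z\<close> there is such a matching containing
  the pair \<open>(t, z)\<close>.  Two different neighbours would contradict the previous paragraph, so every
  simplicial vertex has a single neighbour and \<open>H\<close> is a matching.
\<close>

section \<open>Matched facets and chordal graphs\<close>

text \<open>The relation \<open>E\<close> is not confined to \<open>V\<close>, so passing to an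
  induced subgraph changes only the vertex set.\<close>

locale finite_graph =
  fixes V :: "'a set" and E :: "'a \<Rightarrow> 'a \<Rightarrow> bool"
  assumes finite_V: "finite V"
    and sym: "E u v \<Longrightarrow> E v u"
    and irrefl: "\<not> E u u"
begin

section \<open>Separated sets, components and walks\<close>

definition separated :: "'a set \<Rightarrow> 'a set \<Rightarrow> bool" where
  "separated A B \<longleftrightarrow> A \<inter> B = {} \<and> (\<forall>a\<in>A. \<forall>b\<in>B. \<not> E a b)"

definition connected_set :: "'a set \<Rightarrow> bool" where
  "connected_set W \<longleftrightarrow>
     W \<noteq> {} \<and> (\<forall>A B. W = A \<union> B \<and> A \<noteq> {} \<and> B \<noteq> {} \<longrightarrow> \<not> separated A B)"

definition boundary :: "'a set \<Rightarrow> 'a set" where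
  "boundary W = {v \<in> V - W. \<exists>w\<in>W. E w v}"

definition clique :: "'a set \<Rightarrow> bool" where
  "clique T \<longleftrightarrow> T \<subseteq> V \<and> (\<forall>u\<in>T. \<forall>v\<in>T. u \<noteq> v \<longrightarrow> E u v)"

definition component :: "'a set \<Rightarrow> 'a set \<Rightarrow> bool" where
  "component Y W \<longleftrightarrow> Y \<subseteq> W \<and> connected_set Y \<and> separated Y (W - Y)"

lemma sym_iff: "E u v \<longleftrightarrow> E v u"
  using sym by blast

lemma separated_sym: "separated A B \<longleftrightarrow> separated B A"
  unfolding separated_def using sym by blast

text \<open>Take a set of least size among those that contain \<open>x\<close> and are separated
  from the rest of \<open>W\<close>. If it split into two separated pieces, the piece with
  \<open>x\<close> would be a smaller such set.\<close>

lemma component_exists: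
  assumes "W \<subseteq> V" "x \<in> W"
  obtains Y where "component Y W" "x \<in> Y"
proof -
  let ?P = "\<lambda>Y. Y \<subseteq> W \<and> x \<in> Y \<and> separated Y (W - Y)"
  have fin: "finite W" using assms finite_V finite_subset by blast
  have "?P W" using assms by (auto simp: separated_def)
  then obtain Y where Y: "?P Y" and min: "\<And>Z. ?P Z \<Longrightarrow> card Y \<le> card Z"
    using ex_has_least_nat[of ?P W card] by metis
  have "\<not> separated A B" if AB: "Y = A \<union> B" "A \<noteq> {}" "B \<noteq> {}" for A B
  proof
    assume sep: "separated A B"
    have *: False if "Y = A \<union> B" "B \<noteq> {}" "separated A B" "x \<in> A" for A B
    proof -
      have "?P A" using that Y unfolding separated_def by blast
      moreover have "A \<subset> Y" using that unfolding separated_def by blast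
      then have "card A < card Y" using Y fin finite_subset psubset_card_mono by metis
      ultimately show False using min[of A] by simp
    qed
    have "x \<in> A \<or> x \<in> B" using Y AB by blast
    then show False
    proof
      assume "x \<in> A" then show False using *[of A B] AB sep by blast
    next
      assume "x \<in> B" then show False using *[of B A] AB sep separated_sym by blast
    qed
  qed
  then have "connected_set Y" using Y unfolding connected_set_def by blast
  with Y show ?thesis using that unfolding component_def by blast
qed

text \<open>The vertices reached from \<open>x\<close> by walks inside \<open>W\<close> are
  separated from the rest, so connectedness leaves nothing over. Walks may repeat vertices.\<close>

lemma connected_set_reachable:
  assumes "connected_set W" "x \<in> W" "y \<in> W"
  shows "\<exists>n f. f 0 = x \<and> f n = y \<and> (\<forall>i\<le>n. f i \<in> W) \<and> (\<forall>i<n. E (f i) (f (Suc i)))"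
proof -
  define R where "R = {y \<in> W. \<exists>n f. f 0 = x \<and> f n = y \<and> (\<forall>i\<le>n. f i \<in> W) \<and> (\<forall>i<n. E (f i) (f (Suc i)))}"
  have xR: "x \<in> R"
    unfolding R_def using assms(2) by (auto intro!: exI[of _ 0] exI[of _ "\<lambda>_. x"])
  have "separated R (W - R)"
  proof -
    have False if a: "a \<in> R" and b: "b \<in> W - R" and ab: "E a b" for a b
    proof -
      obtain n f where f: "f 0 = x" "f n = a" "\<forall>i\<le>n. f i \<in> W" "\<forall>i<n. E (f i) (f (Suc i))"
        using a unfolding R_def by blast
      have "b \<in> R"
        unfolding R_def using f b ab
        by (auto intro!: exI[of _ "Suc n"] exI[of _ "f(Suc n := b)"] simp: less_Suc_eq le_Suc_eq)
      with b show False by blast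
    qed
    then show ?thesis unfolding separated_def by blast
  qed
  moreover have "W = R \<union> (W - R)" unfolding R_def by blast
  ultimately have "W - R = {}" using assms(1) xR unfolding connected_set_def by blast
  with assms(3) show ?thesis unfolding R_def by blast
qed

section \<open>Matched facets and their extension\<close>

definition dominates :: "'a set \<Rightarrow> 'a \<Rightarrow> bool" where
  "dominates F u \<longleftrightarrow> (\<exists>w\<in>F. E w u)"

text \<open>\<open>dominates\<close> is domination in the graph, unlike \<open>dominated\<close> for
  complexes. An independent \<open>F\<close> stays independent when one of the vertices collected
  here is added.\<close>

definition undominated :: "'a set \<Rightarrow> 'a set \<Rightarrow> 'a set" where
  "undominated F S = {u \<in> S. \<not> dominates F u}"

text \<open>The last clause says that a partner sees no more of the outside than the vertex it belongs to;
  hence a vertex added later that misses \<open>F\<close> also misses the partners.\<close>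

definition matched_facet :: "'a set \<Rightarrow> 'a set \<Rightarrow> ('a \<Rightarrow> 'a) \<Rightarrow> bool" where
  "matched_facet A F \<pi> \<longleftrightarrow>
     F \<subseteq> A \<and> \<pi> ` F \<subseteq> A \<and> (\<forall>u\<in>A - F. dominates F u) \<and>
     (\<forall>w\<in>F. E w (\<pi> w)) \<and>
     (\<forall>w\<in>F. \<forall>w'\<in>F. w \<noteq> w' \<longrightarrow> \<not> E w w' \<and> \<not> E (\<pi> w) w' \<and> \<not> E (\<pi> w) (\<pi> w')) \<and>
     (\<forall>w\<in>F. \<forall>x\<in>V - A. E x (\<pi> w) \<longrightarrow> E x w)"

lemma matched_facetD:
  assumes "matched_facet A F \<pi>"
  shows "F \<subseteq> A" "\<And>w. w \<in> F \<Longrightarrow> \<pi> w \<in> A" "\<And>u. u \<in> A \<Longrightarrow> u \<notin> F \<Longrightarrow> dominates F u"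
    "\<And>w. w \<in> F \<Longrightarrow> E w (\<pi> w)"
    "\<And>w w'. w \<in> F \<Longrightarrow> w' \<in> F \<Longrightarrow> w \<noteq> w' \<Longrightarrow> \<not> E w w'"
    "\<And>w w'. w \<in> F \<Longrightarrow> w' \<in> F \<Longrightarrow> w \<noteq> w' \<Longrightarrow> \<not> E (\<pi> w) w'"
    "\<And>w w'. w \<in> F \<Longrightarrow> w' \<in> F \<Longrightarrow> w \<noteq> w' \<Longrightarrow> \<not> E (\<pi> w) (\<pi> w')"
    "\<And>w x. w \<in> F \<Longrightarrow> x \<in> V \<Longrightarrow> x \<notin> A \<Longrightarrow> E x (\<pi> w) \<Longrightarrow> E x w"
  using assms by (simp_all add: matched_facet_def image_subset_iff)

lemma matched_facet_empty: "matched_facet {} {} \<pi>"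
  by (simp add: matched_facet_def)

text \<open>\<open>F\<close> and \<open>H\<close> are disjoint because \<open>A\<close> and
  \<open>B\<close> are, so the two partner functions can be pieced together; separation excludes
  edges between the two matchings.\<close>

lemma matched_facet_union:
  assumes "matched_facet A F \<pi>" "matched_facet B H \<rho>" "separated A B"
  obtains \<sigma> where "matched_facet (A \<union> B) (F \<union> H) \<sigma>"
proof -
  let ?\<sigma> = "\<lambda>u. if u \<in> F then \<pi> u else \<rho> u"
  have FA: "F \<subseteq> A" "\<pi> ` F \<subseteq> A" and HB: "H \<subseteq> B" "\<rho> ` H \<subseteq> B"
    using assms unfolding matched_facet_def by auto
  have sep: "\<not> E a b" "\<not> E b a" "a \<noteq> b" if "a \<in> A" "b \<in> B" for a b
    using assms(3) that sym unfolding separated_def by blast+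
  have HF: "u \<notin> F" if "u \<in> H" for u using sep FA HB that by blast
  have "matched_facet (A \<union> B) (F \<union> H) ?\<sigma>"
    unfolding matched_facet_def
  proof (intro conjI ballI impI)
    show "F \<union> H \<subseteq> A \<union> B" using FA HB by blast
    show "?\<sigma> ` (F \<union> H) \<subseteq> A \<union> B" using FA HB by auto
    show "dominates (F \<union> H) u" if "u \<in> A \<union> B - (F \<union> H)" for u
      using that matched_facetD(3)[OF assms(1)] matched_facetD(3)[OF assms(2)]
      unfolding dominates_def by blast
    show "E w (?\<sigma> w)" if "w \<in> F \<union> H" for w
      using that matched_facetD(4)[OF assms(1)] matched_facetD(4)[OF assms(2)] by auto
    show "E x w" if "w \<in> F \<union> H" "x \<in> V - (A \<union> B)" "E x (?\<sigma> w)" for w x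
      using that matched_facetD(8)[OF assms(1), of w x] matched_facetD(8)[OF assms(2), of w x]
      by (cases "w \<in> F") auto
    fix w w' assume w: "w \<in> F \<union> H" "w' \<in> F \<union> H" "w \<noteq> w'"
    have "\<not> E w w' \<and> \<not> E (?\<sigma> w) w' \<and> \<not> E (?\<sigma> w) (?\<sigma> w')"
    proof (cases "w \<in> F")
      case True
      show ?thesis
      proof (cases "w' \<in> F")
        case True
        with w \<open>w \<in> F\<close> show ?thesis using matched_facetD(5-7)[OF assms(1)] by simp
      next
        case False
        then have "w' \<in> B" "\<rho> w' \<in> B" "w \<in> A" "\<pi> w \<in> A" using w True FA HB by auto
        with True False show ?thesis using sep by simp
      qed
    next
      case False
      show ?thesis
      proof (cases "w' \<in> F")
        case True
        then have "w \<in> B" "\<rho> w \<in> B" "w' \<in> A" "\<pi> w' \<in> A" using w False FA HB by auto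
        with True False show ?thesis using sep by simp
      next
        case F: False
        with w False show ?thesis using matched_facetD(5-7)[OF assms(2)] by simp
      qed
    qed
    then show "\<not> E w w'" "\<not> E (?\<sigma> w) w'" "\<not> E (?\<sigma> w) (?\<sigma> w')" by blast+
  qed
  then show ?thesis by (rule that)
qed

text \<open>A larger ambient set weakens the clause about outside vertices and leaves the matching
  untouched, so only domination of the new vertices is at stake.\<close>

lemma matched_facet_enlarge:
  assumes "matched_facet A F \<pi>" "A \<subseteq> A'" "\<forall>u\<in>A' - A. dominates F u"
  shows "matched_facet A' F \<pi>"
proof -
  note F = matched_facetD[OF assms(1)]
  have "F \<subseteq> A'" "\<pi> ` F \<subseteq> A'" using F(1,2) assms(2) by auto
  moreover have "\<forall>u\<in>A' - F. dominates F u" using F(3) assms(3) by blast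
  moreover have "\<forall>w\<in>F. \<forall>x\<in>V - A'. E x (\<pi> w) \<longrightarrow> E x w" using F(8) assms(2) by blast
  ultimately show ?thesis
    unfolding matched_facet_def using F(4-7) by simp
qed

text \<open>The new pair is \<open>t\<close> with partner \<open>v\<close>. Both lie outside
  \<open>A\<close> and miss \<open>g\<close>, so the last clause of \<open>matched_facet\<close>
  makes them miss the partners too; \<open>outer\<close> supplies that clause for the new
  pair.\<close>

lemma matched_facet_insert:
  assumes g: "matched_facet A g \<pi>" "A \<subseteq> A'"
    and dom: "\<And>u. u \<in> A' - A \<Longrightarrow> dominates g u \<or> E t u"
    and t: "t \<in> V - A'" "\<not> dominates g t"
    and v: "v \<in> A'" "v \<in> V - A" "\<not> dominates g v" "E v t"
    and outer: "\<And>y. y \<in> V - A' - {t} \<Longrightarrow> E y v \<Longrightarrow> E y t"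
  obtains \<sigma> where "matched_facet (insert t A') (insert t g) \<sigma>" "\<sigma> t = v"
proof -
  let ?\<sigma> = "\<pi>(t := v)"
  have gA: "g \<subseteq> A" "\<pi> ` g \<subseteq> A" using g unfolding matched_facet_def by auto
  have tg: "t \<notin> g" using gA g t by blast
  have out: "\<not> E y w" "\<not> E w y" "\<not> E y (\<pi> w)" "\<not> E (\<pi> w) y"
    if "w \<in> g" "y \<in> V - A" "\<not> dominates g y" for w y
  proof -
    show *: "\<not> E w y" using that unfolding dominates_def by blast
    then show "\<not> E y w" using sym by blast
    then show "\<not> E y (\<pi> w)" using that matched_facetD(8)[OF g(1)] by blast
    then show "\<not> E (\<pi> w) y" using sym by blast
  qed
  have tA: "t \<in> V - A" using t g by blast
  have "matched_facet (insert t A') (insert t g) ?\<sigma>"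
    unfolding matched_facet_def
  proof (intro conjI ballI impI)
    show "insert t g \<subseteq> insert t A'" using gA g by blast
    show "?\<sigma> ` insert t g \<subseteq> insert t A'" using gA g v tg by auto
    show "dominates (insert t g) u" if "u \<in> insert t A' - insert t g" for u
      using that matched_facetD(3)[OF g(1), of u] dom[of u] unfolding dominates_def by blast
    show "E w (?\<sigma> w)" if "w \<in> insert t g" for w
      using that matched_facetD(4)[OF g(1)] sym[OF v(4)] tg by auto
    show "E x w" if "w \<in> insert t g" "x \<in> V - insert t A'" "E x (?\<sigma> w)" for w x
      using that g(2) outer[of x] tg matched_facetD(8)[OF g(1), of w x] by (cases "w = t") auto
    fix w w' assume w: "w \<in> insert t g" "w' \<in> insert t g" "w \<noteq> w'"
    have "\<not> E w w' \<and> \<not> E (?\<sigma> w) w' \<and> \<not> E (?\<sigma> w) (?\<sigma> w')"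
    proof (cases "w = t"; cases "w' = t")
      assume "w = t" "w' \<noteq> t"
      with w out[of w' t] out[of w' v] tA t(2) v(2,3) show ?thesis by simp
    next
      assume "w \<noteq> t" "w' = t"
      with w out[of w t] out[of w v] tA t(2) v(2,3) show ?thesis by simp
    next
      assume "w \<noteq> t" "w' \<noteq> t"
      with w matched_facetD(5-7)[OF g(1)] show ?thesis by simp
    qed (use w in simp)
    then show "\<not> E w w'" "\<not> E (?\<sigma> w) w'" "\<not> E (?\<sigma> w) (?\<sigma> w')" by blast+
  qed
  then show ?thesis by (rule that) simp
qed

text \<open>Here \<open>x\<close> may have neighbours in both \<open>A\<close> and \<open>B\<close>.
  It misses \<open>f\<close> by assumption, hence also the partners of \<open>f\<close>, while all
  partners \<open>\<pi> w\<close> lie in \<open>A\<close>, away from \<open>B\<close>.\<close>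

lemma matched_facet_union_insert:
  assumes J: "matched_facet (insert x A) J \<pi>" "x \<in> J" "x \<in> V - A - B"
    and f: "matched_facet B f \<rho>" "\<not> dominates f x" "separated A B"
  obtains \<sigma> where "matched_facet (insert x (A \<union> B)) (J \<union> f) \<sigma>"
proof -
  let ?\<sigma> = "\<lambda>u. if u \<in> J then \<pi> u else \<rho> u"
  have JA: "J \<subseteq> insert x A" "\<pi> ` J \<subseteq> insert x A" and fB: "f \<subseteq> B" "\<rho> ` f \<subseteq> B"
    using J f unfolding matched_facet_def by auto
  have \<pi>x: "\<pi> x \<in> A" using J(1,2) irrefl unfolding matched_facet_def by fastforce
  have sep: "\<not> E a b" "\<not> E b a" "a \<noteq> b" if "a \<in> A" "b \<in> B" for a b
    using f(3) that sym unfolding separated_def by blast+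
  have xf: "\<not> E x w" "\<not> E w x" "\<not> E x (\<rho> w)" "\<not> E (\<rho> w) x" if "w \<in> f" for w
  proof -
    show "\<not> E w x" using that f(2) unfolding dominates_def by blast
    then show "\<not> E x w" using sym by blast
    then show "\<not> E x (\<rho> w)" using that J(3) matched_facetD(8)[OF f(1)] by blast
    then show "\<not> E (\<rho> w) x" using sym by blast
  qed
  \<comment> \<open>For \<open>w \<noteq> x\<close>, a partner equal to \<open>x\<close> would join
    two vertices of the independent set \<open>J\<close>.\<close>
  have \<pi>A: "\<pi> w \<in> A" if "w \<in> J" for w
  proof (cases "w = x")
    case False
    then have "\<pi> w \<noteq> x" using matched_facetD(4,5)[OF J(1)] that J(2) by metis
    then show ?thesis using that JA by blast
  qed (simp add: \<pi>x)
  have "matched_facet (insert x (A \<union> B)) (J \<union> f) ?\<sigma>"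
    unfolding matched_facet_def
  proof (intro conjI ballI impI)
    show "J \<union> f \<subseteq> insert x (A \<union> B)" using JA fB by blast
    show "?\<sigma> ` (J \<union> f) \<subseteq> insert x (A \<union> B)" using \<pi>A fB by auto
    show "dominates (J \<union> f) u" if "u \<in> insert x (A \<union> B) - (J \<union> f)" for u
      using that J(2) matched_facetD(3)[OF J(1)] matched_facetD(3)[OF f(1)]
      unfolding dominates_def by blast
    show "E w (?\<sigma> w)" if "w \<in> J \<union> f" for w
      using that matched_facetD(4)[OF J(1)] matched_facetD(4)[OF f(1)] by auto
    show "E y w" if "w \<in> J \<union> f" "y \<in> V - insert x (A \<union> B)" "E y (?\<sigma> w)" for w y
    proof (cases "w \<in> J")
      case True
      then show ?thesis using that matched_facetD(8)[OF J(1), of w y] by simp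
    next
      case False
      then show ?thesis using that matched_facetD(8)[OF f(1), of w y] by simp
    qed
    fix w w' assume w: "w \<in> J \<union> f" "w' \<in> J \<union> f" "w \<noteq> w'"
    have cross: "\<not> E a b \<and> \<not> E (\<pi> a) b \<and> \<not> E (\<pi> a) (\<rho> b) \<and> \<not> E b a \<and> \<not> E (\<rho> b) a \<and> \<not> E (\<rho> b) (\<pi> a)"
      if "a \<in> J" "b \<in> f" for a b
    proof -
      have b: "b \<in> B" "\<rho> b \<in> B" using that fB by auto
      have "\<not> E a b \<and> \<not> E b a \<and> \<not> E (\<rho> b) a"
      proof (cases "a = x")
        case True
        then show ?thesis using xf[OF that(2)] by simp
      next
        case False
        then have "a \<in> A" using that(1) JA(1) by blast
        then show ?thesis using sep(1,2)[of a] b by simp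
      qed
      then show ?thesis using sep(1,2)[OF \<pi>A[OF that(1)]] b by blast
    qed
    have "\<not> E w w' \<and> \<not> E (?\<sigma> w) w' \<and> \<not> E (?\<sigma> w) (?\<sigma> w')"
    proof (cases "w \<in> J"; cases "w' \<in> J")
      assume "w \<in> J" "w' \<in> J"
      with w matched_facetD(5-7)[OF J(1)] show ?thesis by simp
    next
      assume "w \<in> J" "w' \<notin> J" with w cross[of w w'] show ?thesis by simp
    next
      assume "w \<notin> J" "w' \<in> J" with w cross[of w' w] show ?thesis by simp
    next
      assume "w \<notin> J" "w' \<notin> J"
      with w matched_facetD(5-7)[OF f(1)] show ?thesis by simp
    qed
    then show "\<not> E w w'" "\<not> E (?\<sigma> w) w'" "\<not> E (?\<sigma> w) (?\<sigma> w')" by blast+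
  qed
  then show ?thesis by (rule that)
qed

text \<open>If the clique \<open>S\<close> is added to \<open>W\<close>, then either two vertices left over in \<open>S\<close> are matched to
  each other, or none is left over, or one vertex \<open>x\<close> of \<open>S\<close> is matched into \<open>W\<close>.\<close>

definition extendable :: "'a set \<Rightarrow> 'a set \<Rightarrow> bool" where
  "extendable W S \<longleftrightarrow>
     (\<exists>F \<pi>. matched_facet W F \<pi> \<and> card (undominated F S) \<noteq> 1) \<or>
     (\<exists>x\<in>S. \<exists>F \<pi>. matched_facet (insert x W) F \<pi> \<and> x \<in> F)"

section \<open>Cliques and extendability over separated unions\<close>

lemma extendable_emptyD:
  assumes "extendable W {}"
  obtains F \<pi> where "matched_facet W F \<pi>"
  using assms unfolding extendable_def by blast

lemma clique_subset: "clique T \<Longrightarrow> S \<subseteq> T \<Longrightarrow> clique S"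
  by (auto simp: clique_def)

lemma cliqueD: "clique T \<Longrightarrow> T \<subseteq> V" "clique T \<Longrightarrow> u \<in> T \<Longrightarrow> v \<in> T \<Longrightarrow> u \<noteq> v \<Longrightarrow> E u v"
  by (simp_all add: clique_def)

lemma clique_insert: "clique T \<Longrightarrow> p \<in> V \<Longrightarrow> (\<And>t. t \<in> T \<Longrightarrow> E p t) \<Longrightarrow> clique (insert p T)"
  using sym by (auto simp: clique_def)

text \<open>Apply extendability of \<open>A\<close> to the vertices of \<open>S\<close> that
  \<open>g\<close> misses. Apart from \<open>s\<close> they are all dominated by \<open>f\<close>,
  hence lie in \<open>boundary A\<close>; adding \<open>g\<close> to the outcome takes care of the
  other vertices of \<open>S\<close>.\<close>

lemma extendable_union_aux:
  assumes sep: "separated A B" and "A \<union> B \<subseteq> V"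
    and S: "clique S" "S \<subseteq> boundary (A \<union> B)"
    and A: "\<And>X. clique X \<Longrightarrow> X \<subseteq> boundary A \<Longrightarrow> extendable A X"
    and f: "matched_facet A f \<pi>" "matched_facet B g \<rho>"
    and s: "undominated (f \<union> g) S = {s}" "s \<in> boundary A"
  shows "extendable (A \<union> B) S"
proof -
  define X where "X = undominated g S"
  have fA: "f \<subseteq> A" using matched_facetD(1)[OF f(1)] .
  have "X \<subseteq> boundary A"
  proof
    fix x assume x: "x \<in> X"
    show "x \<in> boundary A"
    proof (rule ccontr)
      assume "x \<notin> boundary A"
      moreover have "x \<in> V - A" using x S(2) unfolding X_def undominated_def boundary_def by blast
      ultimately have "\<not> dominates f x" using fA unfolding dominates_def boundary_def by blast
      then have "x \<in> undominated (f \<union> g) S"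
        using x unfolding X_def undominated_def dominates_def by blast
      with s \<open>x \<notin> boundary A\<close> show False by auto
    qed
  qed
  moreover have "clique X"
    by (rule clique_subset[OF S(1)]) (auto simp: X_def undominated_def)
  ultimately consider J \<sigma> where "matched_facet A J \<sigma>" "card (undominated J X) \<noteq> 1"
    | x J \<sigma> where "x \<in> X" "matched_facet (insert x A) J \<sigma>" "x \<in> J"
    using A[of X] unfolding extendable_def by blast
  then show ?thesis
  proof cases
    case (1 J \<sigma>)
    obtain \<tau> where "matched_facet (A \<union> B) (J \<union> g) \<tau>"
      using matched_facet_union[OF 1(1) f(2) sep] .
    moreover have "undominated (J \<union> g) S = undominated J X"
      unfolding X_def undominated_def dominates_def by blast
    ultimately show ?thesis using 1 unfolding extendable_def by metis
  next
    case (2 x J \<sigma>)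
    have "x \<in> V - A - B" "\<not> dominates g x" "x \<in> S"
      using 2 S(2) unfolding X_def undominated_def boundary_def by blast+
    then obtain \<tau> where "matched_facet (insert x (A \<union> B)) (J \<union> g) \<tau>"
      using matched_facet_union_insert[OF 2(2,3) _ f(2) _ sep] by blast
    then show ?thesis using 2(3) \<open>x \<in> S\<close> unfolding extendable_def by blast
  qed
qed

text \<open>The empty clique provides a matched facet on each side. If their union leaves exactly
  one vertex \<open>s\<close> of \<open>S\<close>, this lies in the boundary of one side, and
  \<open>extendable_union_aux\<close> changes the facet on that side.\<close>

lemma extendable_union:
  assumes sep: "separated A B" and AB: "A \<union> B \<subseteq> V"
    and S: "clique S" "S \<subseteq> boundary (A \<union> B)"
    and A: "\<And>X. clique X \<Longrightarrow> X \<subseteq> boundary A \<Longrightarrow> extendable A X"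
    and B: "\<And>X. clique X \<Longrightarrow> X \<subseteq> boundary B \<Longrightarrow> extendable B X"
  shows "extendable (A \<union> B) S"
proof -
  have "clique {}" by (simp add: clique_def)
  then obtain f \<pi> g \<rho> where f: "matched_facet A f \<pi>" and g: "matched_facet B g \<rho>"
    using A[of "{}"] B[of "{}"] by (metis empty_subsetI extendable_emptyD)
  show ?thesis
  proof (cases "card (undominated (f \<union> g) S) = 1")
    case False
    obtain \<sigma> where "matched_facet (A \<union> B) (f \<union> g) \<sigma>" using matched_facet_union[OF f g sep] .
    with False show ?thesis unfolding extendable_def by blast
  next
    case True
    then obtain s where s: "undominated (f \<union> g) S = {s}" using card_1_singletonE by blast
    then have "s \<in> boundary (A \<union> B)" using S unfolding undominated_def by blast
    then have "s \<in> boundary A \<or> s \<in> boundary B" unfolding boundary_def by blast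
    then show ?thesis
    proof
      assume "s \<in> boundary A"
      then show ?thesis using extendable_union_aux[OF sep AB S A f g s] by blast
    next
      assume "s \<in> boundary B"
      then have "extendable (B \<union> A) S"
        using extendable_union_aux[of B A S g \<rho> f \<pi> s] sep AB S B f g s separated_sym
        by (simp add: Un_commute)
      then show ?thesis by (simp add: Un_commute)
    qed
  qed
qed

end

section \<open>Induced cycles and clique boundaries in chordal graphs\<close>

locale chordal_graph = finite_graph +
  assumes no_long_cycle: "\<And>vs. length vs > 3 \<Longrightarrow> distinct vs \<Longrightarrow> set vs \<subseteq> V \<Longrightarrow>
     \<exists>i < length vs. \<exists>j < length vs.
        \<not> (E (vs ! i) (vs ! j) \<longleftrightarrow> j = Suc i mod length vs \<or> i = Suc j mod length vs)"
begin

text \<open>Going from \<open>t\<close> to \<open>r\<close>, then along \<open>f 0, ..., f m\<close>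
  and back to \<open>t\<close> traces an induced cycle with \<open>m + 3\<close> vertices, which is
  more than three since \<open>m\<close> is positive.\<close>

lemma no_cycle_through_edge:
  assumes rt: "E r t" "r \<in> V" "t \<in> V"
    and f: "\<And>i. i \<le> m \<Longrightarrow> f i \<in> V" "0 < m"
    and path: "\<And>i j. i \<le> m \<Longrightarrow> j \<le> m \<Longrightarrow> E (f i) (f j) \<longleftrightarrow> j = Suc i \<or> i = Suc j"
    and inj: "\<And>i j. i < j \<Longrightarrow> j \<le> m \<Longrightarrow> f i \<noteq> f j"
    and r: "\<And>i. i \<le> m \<Longrightarrow> E r (f i) \<longleftrightarrow> i = 0" "\<And>i. i \<le> m \<Longrightarrow> r \<noteq> f i"
    and t: "\<And>i. i \<le> m \<Longrightarrow> E t (f i) \<longleftrightarrow> i = m" "\<And>i. i \<le> m \<Longrightarrow> t \<noteq> f i"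
  shows False
proof -
  let ?vs = "t # r # map f [0..<Suc m]"
  have len: "length ?vs = m + 3" by simp
  have "r \<noteq> t" using rt irrefl by blast
  have nth: "?vs ! i = (if i = 0 then t else if i = 1 then r else f (i - 2))" if "i < m + 3" for i
    using that by (auto simp: nth_Cons split: nat.splits simp del: upt_Suc)
  have "inj_on f {0..<Suc m}"
    by (rule linorder_inj_onI) (use inj in auto)
  moreover have "r \<notin> f ` {0..<Suc m}" "t \<notin> f ` {0..<Suc m}"
    using r(2) t(2) by (force simp: less_Suc_eq_le)+
  ultimately have "distinct ?vs"
    using \<open>r \<noteq> t\<close> by (simp add: distinct_map del: upt_Suc)
  moreover have "set ?vs \<subseteq> V" using rt f by (auto simp del: upt_Suc)
  moreover have "E (?vs ! i) (?vs ! j) \<longleftrightarrow> j = Suc i mod (m + 3) \<or> i = Suc j mod (m + 3)"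
    if ij: "i < m + 3" "j < m + 3" for i j
  proof -
    have ft: "E (f i) t \<longleftrightarrow> i = m" "E (f i) r \<longleftrightarrow> i = 0" if "i \<le> m" for i
      using r(1) t(1) that sym by blast+
    have md: "Suc k mod (m + 3) = (if k = m + 2 then 0 else Suc k)" if "k < m + 3" for k
      using that by (simp add: mod_Suc)
    have E: "E t r" "E r t" "\<not> E t t" "\<not> E r r" using rt sym irrefl by blast+
    \<comment> \<open>Each index belongs to \<open>t\<close>, to \<open>r\<close>, or to a path
      vertex shifted by two; adjacency is compared case by case.\<close>
    have split: "k = 0 \<or> k = 1 \<or> (\<exists>k'\<le>m. k = k' + 2)" if "k < m + 3" for k
      using that by (cases "k < 2") (auto intro!: exI[of _ "k - 2"])
    show ?thesis
      unfolding nth[OF ij(1)] nth[OF ij(2)] md[OF ij(1)] md[OF ij(2)]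
      using split[OF ij(1)] split[OF ij(2)] f(2)
      by (elim disjE exE conjE) (simp_all add: E ft r(1) t(1) path)
  qed
  moreover have "3 < m + 3" using f(2) by simp
  ultimately show False
    using no_long_cycle[of ?vs, unfolded len] by blast
qed

text \<open>A shortest path leaving the common neighbours of \<open>T\<close> and ending next to a further
  vertex \<open>t\<close> would close up to a long induced cycle through \<open>t\<close> and a vertex of \<open>T\<close>.\<close>

lemma clique_common_neighbour:
  assumes "W \<subseteq> V" "connected_set W" "clique T" "T \<subseteq> boundary W"
  shows "\<exists>p\<in>W. \<forall>t\<in>T. E p t"
proof -
  have "finite T" using cliqueD(1)[OF assms(3)] finite_V by (rule finite_subset)
  from this assms(3,4) show ?thesis
  proof (induction T rule: finite_induct)
    case empty
    then show ?case using assms(2) unfolding connected_set_def by blast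
  next
    case (insert t T)
    define Y where "Y = {p \<in> W. \<forall>r\<in>T. E p r}"
    have "clique T" "T \<subseteq> boundary W" using insert.prems clique_subset[of "insert t T" T] by auto
    then obtain p0 where p0: "p0 \<in> Y" using insert.IH Y_def by blast
    obtain q0 where q0: "q0 \<in> W" "E q0 t" using insert.prems unfolding boundary_def by blast
    \<comment> \<open>A walk with least \<open>n\<close> will be taken; \<open>n = 0\<close> means
      that a single vertex of \<open>W\<close> already sees all of
      \<open>insert t T\<close>.\<close>
    define P where "P n = (\<exists>f. f 0 \<in> Y \<and> E (f n) t \<and> (\<forall>i\<le>n. f i \<in> W) \<and> (\<forall>i<n. E (f i) (f (Suc i))))" for n
    have "\<exists>n. P n"
      using connected_set_reachable[OF assms(2), of p0 q0] p0 q0 unfolding P_def Y_def by blast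
    then obtain n where n: "P n" and min: "\<And>k. k < n \<Longrightarrow> \<not> P k"
      using exists_least_iff[of P] by blast
    obtain f where f: "f 0 \<in> Y" "E (f n) t" "\<And>i. i \<le> n \<Longrightarrow> f i \<in> W" "\<And>i. i < n \<Longrightarrow> E (f i) (f (Suc i))"
      using n unfolding P_def by blast
    have tW: "t \<notin> W" "t \<in> V" using insert.prems unfolding boundary_def by auto
    show ?case
    proof (cases "n = 0")
      case True
      then show ?thesis using f unfolding Y_def by auto
    next
      case False
      have ft: "\<not> E (f i) t" if "i < n" for i
        using min[OF that] f that unfolding P_def by (metis less_trans order.strict_implies_order le_less_trans)
      \<comment> \<open>Otherwise a shorter walk could start at \<open>f i\<close>.\<close>
      have fY: "f i \<notin> Y" if i: "0 < i" "i \<le> n" for i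
      proof
        assume "f i \<in> Y"
        then have "P (n - i)"
          unfolding P_def using f i by (intro exI[of _ "\<lambda>k. f (i + k)"]) auto
        then show False using min[of "n - i"] i by simp
      qed
      have short: "\<not> (E (f i) (f j) \<or> f i = f j)" if ij: "Suc i < j" "j \<le> n" for i j
      proof
        assume a: "E (f i) (f j) \<or> f i = f j"
        \<comment> \<open>Jumping from \<open>f i\<close> to \<open>f j\<close> saves
          \<open>j - Suc i\<close> steps along an edge, and one more if the two vertices
          coincide.\<close>
        define d where "d = (if E (f i) (f j) then j - Suc i else j - i)"
        define g where "g = (\<lambda>k. if k \<le> i then f k else f (k + d))"
        have d: "0 < d" "d + i < n + 1" "d \<le> n" "d \<le> j" using ij by (auto simp: d_def)
        have "P (n - d)"
        proof -
          have "g 0 \<in> Y" using f by (simp add: g_def)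
          moreover have "E (g (n - d)) t"
          proof (cases "n - d \<le> i")
            case True
            \<comment> \<open>Only a coincidence of \<open>f i\<close> with the endpoint
              \<open>f n\<close> leaves no step after index \<open>i\<close>.\<close>
            have "n - d = i" "j = n" "d = j - i"
              using True ij by (auto simp: d_def split: if_splits)
            then have "f i = f n" using a d_def ij by (auto split: if_splits)
            then show ?thesis using f(2) \<open>n - d = i\<close> by (simp add: g_def)
          next
            case False
            then show ?thesis using f(2) d by (simp add: g_def)
          qed
          moreover have "\<forall>k\<le>n - d. g k \<in> W" using f(3) d ij by (auto simp: g_def)
          moreover have "E (g k) (g (Suc k))" if k: "k < n - d" for k
          proof -
            consider "k < i" | "k = i" | "k > i" by linarith
            then show ?thesis
            proof cases
              case 1 then show ?thesis using f(4)[of k] ij by (simp add: g_def)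
            next
              case 3 then show ?thesis using f(4)[of "k + d"] k by (simp add: g_def)
            next
              case 2
              show ?thesis
              proof (cases "E (f i) (f j)")
                case True
                then show ?thesis using 2 ij by (simp add: g_def d_def)
              next
                case False
                then have "f i = f j" "d = j - i" using a by (auto simp: d_def)
                then show ?thesis using 2 ij f(4)[of j] k by (simp add: g_def)
              qed
            qed
          qed
          ultimately show ?thesis unfolding P_def by blast
        qed
        then show False using min[of "n - d"] d by simp
      qed
      have "f n \<notin> Y" using fY[of n] False by simp
      then obtain r where r: "r \<in> T" "\<not> E (f n) r" using f(3) unfolding Y_def by blast
      \<comment> \<open>The cycle starts at the last walk vertex adjacent to \<open>r\<close>:
        between \<open>f j\<close> and \<open>f n\<close> only the first vertex sees
        \<open>r\<close> and only the last one sees \<open>t\<close>, while \<open>r\<close> and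
        \<open>t\<close> are adjacent.\<close>
      define j where "j = Max {i. i \<le> n \<and> E (f i) r}"
      have "0 \<in> {i. i \<le> n \<and> E (f i) r}" using f(1) r unfolding Y_def by blast
      then have "j \<in> {i. i \<le> n \<and> E (f i) r}"
        unfolding j_def by (intro Max_in) auto
      then have j: "j \<le> n" "E (f j) r" by auto
      have jmax: "\<not> E (f i) r" if "j < i" "i \<le> n" for i
      proof
        assume "E (f i) r"
        then have "i \<le> j" unfolding j_def using that by (intro Max_ge) auto
        with that show False by simp
      qed
      have "j < n" using j r by (metis le_neq_implies_less)
      have rW: "r \<notin> W" "r \<in> V" using r insert.prems unfolding boundary_def by auto
      have rt: "E r t"
        using r(1) insert.hyps(2) by (intro cliqueD(2)[OF insert.prems(1)]) auto
      have neigh: "E (f i) (f (Suc i))" "f i \<noteq> f (Suc i)" if "i < n" for i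
        using f(4)[OF that] irrefl by metis+
      have False
      proof (rule no_cycle_through_edge[of r t "n - j" "\<lambda>i. f (j + i)"])
        show "E r t" "r \<in> V" "t \<in> V" by fact+
        show "0 < n - j" using \<open>j < n\<close> by simp
        show "f (j + i) \<in> V" if "i \<le> n - j" for i
          using f(3)[of "j + i"] that assms(1) j by auto
        show "E (f (j + i)) (f (j + k)) \<longleftrightarrow> k = Suc i \<or> i = Suc k" if "i \<le> n - j" "k \<le> n - j" for i k
        proof -
          consider "i = k" | "k = Suc i" | "i = Suc k" | "Suc i < k" | "Suc k < i" by linarith
          then show ?thesis
          proof cases
            case 1 then show ?thesis using irrefl by simp
          next
            case 2 then show ?thesis using neigh[of "j + i"] that j by simp
          next
            case 3 then show ?thesis using sym[OF neigh(1)[of "j + k"]] that j by simp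
          next
            case 4 then show ?thesis using short[of "j + i" "j + k"] that j by simp
          next
            case 5
            moreover have "j + i \<le> n" using that j by linarith
            ultimately show ?thesis
              using short[of "j + k" "j + i"] sym_iff[of "f (j + i)" "f (j + k)"] by simp
          qed
        qed
        show "f (j + i) \<noteq> f (j + k)" if "i < k" "k \<le> n - j" for i k
        proof (cases "k = Suc i")
          case True then show ?thesis using neigh[of "j + i"] that j by simp
        next
          case False then show ?thesis using short[of "j + i" "j + k"] that j by simp
        qed
        show "E r (f (j + i)) \<longleftrightarrow> i = 0" if "i \<le> n - j" for i
        proof (cases "i = 0")
          case True
          then show ?thesis using j sym_iff[of r] by simp
        next
          case False
          then have "j < j + i" "j + i \<le> n" using that j by linarith+
          then show ?thesis using jmax[of "j + i"] False sym_iff[of r] by simp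
        qed
        show "E t (f (j + i)) \<longleftrightarrow> i = n - j" if "i \<le> n - j" for i
        proof (cases "i = n - j")
          case True
          then show ?thesis using f(2) j sym_iff[of t] by simp
        next
          case False
          then have "j + i < n" using that by linarith
          then show ?thesis using ft[of "j + i"] False sym_iff[of t] by simp
        qed
        show "r \<noteq> f (j + i)" "t \<noteq> f (j + i)" if "i \<le> n - j" for i
        proof -
          have "f (j + i) \<in> W" using f(3)[of "j + i"] that j by linarith
          then show "r \<noteq> f (j + i)" "t \<noteq> f (j + i)" using rW tW by auto
        qed
      qed
      then show ?thesis ..
    qed
  qed
qed

text \<open>Some \<open>p\<close> in \<open>W\<close> sees the whole boundary. If
  \<open>W = {p}\<close>, the neighbours of \<open>p\<close> are the boundary, a clique. Otherwise a
  component of \<open>W - {p}\<close> is smaller, and its boundary lies in the clique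
  \<open>insert p (boundary W)\<close>, so induction applies.\<close>

lemma simplicial_vertex_exists:
  assumes "W \<subseteq> V" "connected_set W" "clique (boundary W)"
  shows "\<exists>z\<in>W. clique {v \<in> V. E z v}"
  using assms
proof (induction "card W" arbitrary: W rule: less_induct)
  case less
  obtain p where p: "p \<in> W" "\<And>t. t \<in> boundary W \<Longrightarrow> E p t"
    using clique_common_neighbour[OF less.prems(1,2,3)] by blast
  show ?case
  proof (cases "W = {p}")
    case True
    have "{v \<in> V. E p v} = boundary W"
      unfolding boundary_def True using irrefl by auto
    with less.prems(3) p(1) show ?thesis by metis
  next
    case False
    then obtain x where x: "x \<in> W - {p}" using p by blast
    have "W - {p} \<subseteq> V" using less.prems by blast
    then obtain Y where Y: "component Y (W - {p})" "x \<in> Y"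
      using component_exists x by blast
    have "boundary Y \<subseteq> insert p (boundary W)"
      using Y less.prems(1) unfolding boundary_def component_def separated_def by blast
    moreover have "clique (insert p (boundary W))"
      using less.prems(1,3) p by (intro clique_insert) auto
    ultimately have "clique (boundary Y)" using clique_subset by metis
    moreover have "card Y < card W"
      using Y p less.prems(1) finite_V unfolding component_def
      by (intro psubset_card_mono) (auto intro: finite_subset)
    moreover have "Y \<subseteq> V" "connected_set Y" using Y less.prems unfolding component_def by auto
    ultimately obtain z where "z \<in> Y" "clique {v \<in> V. E z v}" using less.hyps[of Y] by metis
    then show ?thesis using Y unfolding component_def by blast
  qed
qed

section \<open>Matched facets from guarded vertex sets\<close>

text \<open>The vertex \<open>z\<close> rules out a component \<open>{p}\<close> in a graph without inclusions between
  neighbourhoods; such a component has no matched facet.\<close>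

definition guarded :: "'a set \<Rightarrow> bool" where
  "guarded W \<longleftrightarrow>
     (\<forall>Y. component Y W \<longrightarrow> clique (boundary Y) \<and> (\<exists>z\<in>V - Y. \<forall>t\<in>boundary Y. E z t))"

text \<open>Since \<open>B\<close> is separated from \<open>A\<close>, components of
  \<open>A\<close> remain components of the union.\<close>

lemma guarded_split:
  assumes "guarded (A \<union> B)" "separated A B"
  shows "guarded A"
proof -
  have "component Y (A \<union> B)" if "component Y A" for Y
    using that assms(2) unfolding component_def separated_def by blast
  then show ?thesis using assms(1) unfolding guarded_def by blast
qed

text \<open>The second conjunct feeds the first one: it provides the induced matchings in which a
  vertex \<open>t\<close> outside \<open>W\<close> is matched to a vertex that only \<open>t\<close> dominates.\<close>

lemma guarded_extendable:
  assumes stiff: "\<And>u v. u \<in> V \<Longrightarrow> v \<in> V \<Longrightarrow> u \<noteq> v \<Longrightarrow> \<exists>x\<in>V. E u x \<and> \<not> E v x"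
    and "W \<subseteq> V" "guarded W"
  shows "(\<forall>S. clique S \<and> S \<subseteq> boundary W \<longrightarrow> extendable W S) \<and>
    (\<forall>t\<in>V - W. \<exists>F \<pi>. matched_facet {w \<in> W. \<not> E t w} F \<pi>)"
  using assms(2,3)
proof (induction "card W" arbitrary: W rule: less_induct)
  case less
  have finW: "finite W" using less.prems finite_V finite_subset by blast
  consider "W = {}" | A B where "W = A \<union> B" "A \<noteq> {}" "B \<noteq> {}" "separated A B" | "connected_set W"
    unfolding connected_set_def by blast
  then show ?case
  proof cases
    case 1
    then show ?thesis
      using matched_facet_empty unfolding extendable_def boundary_def undominated_def by fastforce
  next
    case (2 A B)
    have "A \<subset> W" "B \<subset> W" using 2 unfolding separated_def by blast+
    then have card: "card A < card W" "card B < card W" using psubset_card_mono[OF finW] by auto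
    have "guarded A" "guarded B"
      using guarded_split less.prems 2 separated_sym by (metis, metis Un_commute)
    note IH = less.hyps[OF card(1) _ \<open>guarded A\<close>] less.hyps[OF card(2) _ \<open>guarded B\<close>]
    show ?thesis
    proof (intro conjI allI impI ballI)
      fix S assume "clique S \<and> S \<subseteq> boundary W"
      then show "extendable W S"
        using extendable_union[of A B S] IH 2 less.prems by blast
    next
      fix t assume t: "t \<in> V - W"
      obtain f \<pi> g \<rho> where fg: "matched_facet {w \<in> A. \<not> E t w} f \<pi>" "matched_facet {w \<in> B. \<not> E t w} g \<rho>"
        using IH t 2 less.prems by blast
      have "separated {w \<in> A. \<not> E t w} {w \<in> B. \<not> E t w}" using 2 unfolding separated_def by blast
      then obtain \<sigma> where "matched_facet ({w \<in> A. \<not> E t w} \<union> {w \<in> B. \<not> E t w}) (f \<union> g) \<sigma>"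
        using matched_facet_union fg by blast
      moreover have "{w \<in> A. \<not> E t w} \<union> {w \<in> B. \<not> E t w} = {w \<in> W. \<not> E t w}" using 2 by blast
      ultimately show "\<exists>F \<pi>. matched_facet {w \<in> W. \<not> E t w} F \<pi>" by metis
    qed
  next
    case 3
    define T where "T = boundary W"
    have "component W W" using 3 unfolding component_def separated_def by blast
    then obtain z where T: "clique T" and z: "z \<in> V - W" "\<And>t. t \<in> T \<Longrightarrow> E z t"
      using less.prems(2) unfolding guarded_def T_def by blast
    have TW: "T \<inter> W = {}" "T \<subseteq> V" unfolding T_def boundary_def by blast+
    \<comment> \<open>\<open>P\<close> will be a maximal clique between \<open>T\<close> and
      \<open>T \<union> W\<close>, so no vertex of \<open>W\<close> sees all of \<open>P\<close>.
      The induction continues with \<open>W\<close> minus the part of \<open>P\<close> inside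
      it.\<close>
    define \<P> where "\<P> = {P. clique P \<and> T \<subseteq> P \<and> P \<subseteq> T \<union> W}"
    have "finite \<P>"
      by (rule finite_subset[of _ "Pow V"]) (auto simp: \<P>_def clique_def finite_V)
    moreover have "T \<in> \<P>" using T by (simp add: \<P>_def)
    ultimately obtain P where P: "P \<in> \<P>" and Pmax: "\<And>Q. Q \<in> \<P> \<Longrightarrow> P \<subseteq> Q \<Longrightarrow> Q = P"
      by (metis finite_has_maximal2)
    have noext: "\<not> (\<forall>t\<in>P. E p t)" if "p \<in> W" for p
    proof
      assume a: "\<forall>t\<in>P. E p t"
      then have "clique (insert p P)"
        using P that less.prems(1) by (intro clique_insert) (auto simp: \<P>_def)
      then have "insert p P \<in> \<P>" using P that by (auto simp: \<P>_def)
      then have "insert p P = P" by (intro Pmax) auto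
      then have "p \<in> P" by (metis insertI1)
      with a irrefl show False by metis
    qed
    define P0 where "P0 = P - T"
    define W' where "W' = W - P0"
    have Pc: "clique P" "T \<subseteq> P" "P \<subseteq> T \<union> W" using P unfolding \<P>_def by auto
    have PE: "E u v" if "u \<in> P" "v \<in> P" "u \<noteq> v" for u v
      using cliqueD(2)[OF Pc(1)] that .
    have P0: "P0 \<subseteq> W" "P = T \<union> P0" "P0 \<inter> T = {}" using Pc unfolding P0_def by auto
    \<comment> \<open>If \<open>P\<close> were just \<open>T\<close>, a common neighbour of
      \<open>T\<close> in \<open>W\<close> would contradict maximality.\<close>
    have "P0 \<noteq> {}"
      using clique_common_neighbour[OF less.prems(1) 3 T] noext P0 unfolding T_def by auto
    have W': "W' \<subset> W" "W' \<union> P0 = W" "W' \<inter> P0 = {}" "W' \<subseteq> V"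
      using P0 \<open>P0 \<noteq> {}\<close> less.prems unfolding W'_def by auto
    then have card: "card W' < card W" using psubset_card_mono[OF finW] by blast
    have bW': "boundary Y \<subseteq> P" if Y: "Y \<subseteq> W'" "separated Y (W' - Y)" for Y
    proof
      fix v assume "v \<in> boundary Y"
      then obtain w where w: "v \<in> V - Y" "w \<in> Y" "E w v" unfolding boundary_def by blast
      show "v \<in> P"
      proof (cases "v \<in> W")
        case True
        have "v \<notin> W'" using w Y unfolding separated_def by blast
        then show ?thesis using True W' P0 by blast
      next
        case False
        then show ?thesis using w Y W' P0(2) unfolding T_def boundary_def by blast
      qed
    qed
    \<comment> \<open>Whatever sees \<open>W'\<close> from outside belongs to the clique
      \<open>P\<close>. This yields the last clause of \<open>matched_facet\<close> for a partner in
      \<open>W'\<close>.\<close>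
    have outer: "E y t" if "v \<in> W'" "y \<in> V - W'" "E y v" "t \<in> P" "t \<noteq> y" for v y t
    proof -
      have "y \<in> boundary W'" using that sym unfolding boundary_def by blast
      then show ?thesis using bW'[of W'] PE that unfolding separated_def by blast
    qed
    \<comment> \<open>The boundary of a component has a common neighbour in \<open>W\<close>, so it
      is a proper part of \<open>P\<close>; a vertex of \<open>P\<close> left over serves as
      guard.\<close>
    have "guarded W'"
      unfolding guarded_def
    proof (intro allI impI)
      fix Y assume Y: "component Y W'"
      then have bY: "boundary Y \<subseteq> P" using bW' unfolding component_def by blast
      then have cl: "clique (boundary Y)" using clique_subset[OF Pc(1)] by blast
      have "Y \<subseteq> V" "Y \<subseteq> W" using Y W' unfolding component_def by auto
      then have "\<exists>p\<in>W. \<forall>t\<in>boundary Y. E p t"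
        using clique_common_neighbour[OF \<open>Y \<subseteq> V\<close> _ cl] Y unfolding component_def by blast
      then have "boundary Y \<noteq> P" using noext by metis
      then obtain y where y: "y \<in> P" "y \<notin> boundary Y" using bY by blast
      have "y \<notin> Y" using y Y P0 W' TW unfolding component_def by blast
      moreover have "\<forall>t\<in>boundary Y. E y t" using y bY PE by blast
      moreover have "y \<in> V" using y(1) cliqueD(1)[OF Pc(1)] by auto
      ultimately show "clique (boundary Y) \<and> (\<exists>z\<in>V - Y. \<forall>t\<in>boundary Y. E z t)"
        using cl by blast
    qed
    note hyp = less.hyps[OF card W'(4) this]
    have IH: "extendable W' S'" if "clique S'" "S' \<subseteq> boundary W'" for S'
      using hyp that by simp
    have IHC: "\<exists>F \<pi>. matched_facet {w \<in> W'. \<not> E t w} F \<pi>" if "t \<in> V - W'" for t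
      using hyp that by simp
    have ext: "extendable W S" if S: "S \<subseteq> T" for S
    proof -
      \<comment> \<open>A facet of \<open>W'\<close> becomes one of \<open>W\<close> only if
        \<open>P0\<close> is dominated or used, so the clique tested against \<open>W'\<close>
        includes \<open>P0\<close> besides \<open>S\<close>.\<close>
      define B where "B = S \<union> P0"
      have BP: "B \<subseteq> P" using S P0 unfolding B_def by blast
      moreover have "P \<inter> W' = {}" using P0 TW W' by blast
      moreover have "P \<subseteq> V" using cliqueD(1)[OF Pc(1)] .
      ultimately have B: "B \<subseteq> P" "clique B" "B \<inter> W' = {}" "B \<subseteq> V"
        using clique_subset[OF Pc(1)] by blast+
      have SW: "S \<inter> W = {}" using S TW by blast
      \<comment> \<open>If \<open>f\<close> misses some \<open>p\<close> in \<open>P0\<close>, it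
        misses a second vertex \<open>q\<close> of the clique \<open>B\<close>, and the two are
        matched. For \<open>q\<close> in \<open>P0\<close> the facet vertex \<open>p\<close>
        dominates \<open>S\<close>; for \<open>q\<close> in \<open>S\<close> the second alternative
        of \<open>extendable\<close> holds with \<open>x = q\<close>.\<close>
      have finish1: "extendable W S"
        if f: "matched_facet W' f \<pi>" "card (undominated f B) \<noteq> 1" for f \<pi>
      proof (cases "undominated f P0 = {}")
        case True
        then have "\<forall>u\<in>W - W'. dominates f u" using W' unfolding undominated_def by blast
        then have "matched_facet W f \<pi>" using matched_facet_enlarge[OF f(1)] W' by blast
        moreover have "undominated f B = undominated f S"
          using True unfolding B_def undominated_def by blast
        ultimately show ?thesis using f(2) unfolding extendable_def by metis
      next
        case False
        then obtain p where p: "p \<in> P0" "\<not> dominates f p" unfolding undominated_def by blast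
        have "undominated f B \<noteq> {p}" using f(2) by auto
        then obtain q where q: "q \<in> B" "\<not> dominates f q" "q \<noteq> p"
          using p unfolding undominated_def B_def by blast
        have pq: "E p q" "E q p" using PE p q B P0 by blast+
        have pV: "p \<in> V - W'" "q \<in> V - W'" using p q B unfolding B_def by blast+
        show ?thesis
        proof (cases "q \<in> P0")
          case True
          obtain \<sigma> where "matched_facet (insert p (W - {p})) (insert p f) \<sigma>"
          proof (rule matched_facet_insert[OF f(1), of "W - {p}" p q])
            show "W' \<subseteq> W - {p}" using W' p by blast
            show "dominates f u \<or> E p u" if "u \<in> W - {p} - W'" for u
              using that W' p PE[of p u] P0 by blast
            show "p \<in> V - (W - {p})" using pV by blast
            show "q \<in> W - {p}" using True q P0 by blast
            fix y assume y: "y \<in> V - (W - {p}) - {p}" "E y q"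
            then have "y \<in> T" using True P0 sym unfolding T_def boundary_def by blast
            then show "E y p" using PE p P0 by blast
          qed (use p q pq pV in auto)
          moreover have "insert p (W - {p}) = W" using p P0 by blast
          moreover have "undominated (insert p f) S = {}"
            using S P0 PE p unfolding undominated_def dominates_def by blast
          ultimately show ?thesis unfolding extendable_def by (metis card.empty zero_neq_one)
        next
          case False
          then have qS: "q \<in> S" using q unfolding B_def by blast
          then have qW: "q \<notin> W" using SW by blast
          obtain \<sigma> where "matched_facet (insert q W) (insert q f) \<sigma>"
          proof (rule matched_facet_insert[OF f(1), of W q p])
            show "W' \<subseteq> W" using W' by blast
            show "dominates f u \<or> E q u" if "u \<in> W - W'" for u
              using that W' qS qW S PE[of q u] P0 by blast
            show "q \<in> V - W" using pV qW by blast
            show "p \<in> W" using p P0 by blast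
            fix y assume y: "y \<in> V - W - {q}" "E y p"
            then have "y \<in> T" using p P0 sym unfolding T_def boundary_def by blast
            then show "E y q" using PE qS S P0 y by blast
          qed (use p q pq pV in auto)
          then show ?thesis using qS unfolding extendable_def by blast
        qed
      qed
      \<comment> \<open>A facet vertex \<open>x\<close> in the clique \<open>B\<close> dominates the
        rest of \<open>P0\<close>, so the facet enlarges. For \<open>x\<close> in \<open>S\<close>
        this is the second alternative of \<open>extendable\<close>; for \<open>x\<close> in
        \<open>P0\<close> the first, with all of \<open>S\<close> dominated.\<close>
      have finish2: "extendable W S"
        if F: "matched_facet (insert x W') F \<pi>" "x \<in> F" "x \<in> B" for x F \<pi>
      proof (cases "x \<in> S")
        case True
        have "\<forall>u\<in>insert x W - insert x W'. dominates F u"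
          using F B(1) W' PE[of x] P0 unfolding dominates_def by blast
        moreover have "insert x W' \<subseteq> insert x W" using W' by blast
        ultimately have "matched_facet (insert x W) F \<pi>"
          using matched_facet_enlarge[OF F(1)] by metis
        with True F show ?thesis unfolding extendable_def by blast
      next
        case False
        then have x: "x \<in> P0" using F unfolding B_def by blast
        have "\<forall>u\<in>W - insert x W'. dominates F u"
          using F x W' PE[of x] P0 unfolding dominates_def by blast
        moreover have "insert x W' \<subseteq> W" using W' x by blast
        ultimately have "matched_facet W F \<pi>"
          using matched_facet_enlarge[OF F(1)] by metis
        moreover have "undominated F S = {}"
          using S P0 PE[of x] x F(2) unfolding undominated_def dominates_def by blast
        ultimately show ?thesis unfolding extendable_def by (metis card.empty zero_neq_one)
      qed
      show ?thesis
      proof (cases "B \<subseteq> boundary W'")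
        case True
        then have "extendable W' B" by (rule IH[OF B(2)])
        then consider F \<pi> where "matched_facet W' F \<pi>" "card (undominated F B) \<noteq> 1"
          | x F \<pi> where "x \<in> B" "matched_facet (insert x W') F \<pi>" "x \<in> F"
          unfolding extendable_def by metis
        then show ?thesis using finish1 finish2 by cases metis+
      next
        case False
        \<comment> \<open>Now \<open>s\<close> sees nothing of \<open>W'\<close>, and the second
          part of the induction hypothesis takes over.\<close>
        then obtain s where s: "s \<in> B" "s \<notin> boundary W'" by blast
        have sW': "\<not> E w s" if "w \<in> W'" for w
          using s that B unfolding boundary_def by blast
        show ?thesis
        proof (cases "B = {s}")
          case True
          \<comment> \<open>Here the guard enters: all neighbours of \<open>s\<close> lie in
            \<open>T\<close>, which \<open>z\<close> sees entirely, against the absence of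
            inclusions between neighbourhoods.\<close>
          then have sP0: "P0 = {s}"
            using \<open>P0 \<noteq> {}\<close> unfolding B_def by (metis Un_upper2 subset_singletonD)
          then have "s \<noteq> z" "s \<in> V" "z \<in> V" using z P0 less.prems by auto
          then obtain x where x: "x \<in> V" "E s x" "\<not> E z x" using stiff[of s z] by blast
          have "x \<notin> W" using x sW' W' sP0 sym irrefl by blast
          then have "x \<in> T" using x sP0 P0 unfolding T_def boundary_def by blast
          then show ?thesis using z x by blast
        next
          case False
          then obtain t where t: "t \<in> B" "t \<noteq> s" using s by blast
          then have tV: "t \<in> V - W'" using B by blast
          then obtain g \<pi> where g: "matched_facet {w \<in> W'. \<not> E t w} g \<pi>" using IHC[OF tV] by metis
          have gW: "g \<subseteq> {w \<in> W'. \<not> E t w}" using matched_facetD(1)[OF g] .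
          have ndt: "\<not> dominates g t" using gW sym unfolding dominates_def by blast
          \<comment> \<open>\<open>g\<close> avoids the neighbours of \<open>t\<close>. If it
            dominates the rest of \<open>W'\<close>, both \<open>s\<close> and \<open>t\<close> stay
            undominated; otherwise an undominated neighbour \<open>v\<close> of \<open>t\<close>
            becomes its partner.\<close>
          show ?thesis
          proof (cases "\<forall>u\<in>W' - {w \<in> W'. \<not> E t w}. dominates g u")
            case True
            then have "matched_facet W' g \<pi>" by (intro matched_facet_enlarge[OF g]) auto
            moreover have "card (undominated g B) \<noteq> 1"
            proof
              assume "card (undominated g B) = 1"
              then obtain x where "undominated g B = {x}" using card_1_singletonE by blast
              moreover have "s \<in> undominated g B"
                using s sW' gW unfolding undominated_def dominates_def by blast
              moreover have "t \<in> undominated g B" using t ndt unfolding undominated_def by blast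
              ultimately show False using t by auto
            qed
            ultimately show ?thesis using finish1 by blast
          next
            case False
            then obtain v where v: "v \<in> W'" "E t v" "\<not> dominates g v" by blast
            obtain \<sigma> where "matched_facet (insert t W') (insert t g) \<sigma>"
            proof (rule matched_facet_insert[OF g, of W' t v])
              show "E y t" if "y \<in> V - W' - {t}" "E y v" for y
                using outer[of v y t] that v t B by blast
              show "v \<in> V - {w \<in> W'. \<not> E t w}" using v W' by blast
              show "E v t" using v sym by blast
            qed (use v tV ndt in auto)
            then show ?thesis using finish2 t by blast
          qed
        qed
      qed
    qed
    show ?thesis
    proof (intro conjI allI impI ballI)
      show "extendable W S" if "clique S \<and> S \<subseteq> boundary W" for S
        using ext that unfolding T_def by blast
      fix t assume t: "t \<in> V - W"
      show "\<exists>F \<pi>. matched_facet {w \<in> W. \<not> E t w} F \<pi>"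
      proof (cases "t \<in> T")
        case False
        then have "{w \<in> W. \<not> E t w} = W" using t sym unfolding T_def boundary_def by blast
        then show ?thesis using ext[of "{}"] extendable_emptyD by (metis empty_subsetI)
      next
        case True
        \<comment> \<open>\<open>t\<close> sees all of \<open>P0\<close>, so \<open>W\<close> and
          \<open>W'\<close> leave the same set.\<close>
        then have "{w \<in> W. \<not> E t w} = {w \<in> W'. \<not> E t w}"
          using W' P0 PE[of t] by blast
        moreover have "t \<in> V - W'" using t W' by blast
        ultimately show ?thesis using IHC by metis
      qed
    qed
  qed
qed

text \<open>Components outside the closed neighbourhood of \<open>z\<close> have their boundary
  among the neighbours of \<open>z\<close>, so \<open>z\<close> guards them all. The facet found
  away from \<open>t\<close> is completed by the pair of \<open>t\<close> and \<open>z\<close>; as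
  the neighbours of \<open>z\<close> form a clique, \<open>t\<close> dominates what remains.\<close>

lemma simplicial_matched_facet:
  assumes stiff: "\<And>u v. u \<in> V \<Longrightarrow> v \<in> V \<Longrightarrow> u \<noteq> v \<Longrightarrow> \<exists>x\<in>V. E u x \<and> \<not> E v x"
    and z: "z \<in> V" "clique {v \<in> V. E z v}" and t: "t \<in> V" "E z t"
  obtains F \<pi> where "matched_facet V F \<pi>" "t \<in> F" "\<pi> t = z"
proof -
  define W where "W = V - insert z {v \<in> V. E z v}"
  have b: "boundary Y \<subseteq> {v \<in> V. E z v}" if "component Y W" for Y
    using that sym unfolding boundary_def component_def separated_def W_def by blast
  have "guarded W"
    unfolding guarded_def
  proof (intro allI impI conjI)
    fix Y assume Y: "component Y W"
    show "clique (boundary Y)" by (rule clique_subset[OF z(2) b[OF Y]])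
    show "\<exists>z\<in>V - Y. \<forall>t\<in>boundary Y. E z t"
    proof
      show "\<forall>t\<in>boundary Y. E z t" using b[OF Y] by auto
      show "z \<in> V - Y" using z(1) Y unfolding component_def W_def by auto
    qed
  qed
  moreover have tW: "t \<in> V - W" and "W \<subseteq> V" using t unfolding W_def by auto
  ultimately have "\<forall>t\<in>V - W. \<exists>F \<pi>. matched_facet {w \<in> W. \<not> E t w} F \<pi>"
    using guarded_extendable[OF stiff] by simp
  then obtain g \<pi> where g: "matched_facet {w \<in> W. \<not> E t w} g \<pi>" using tW by (elim ballE exE) auto
  have gW: "g \<subseteq> {w \<in> W. \<not> E t w}" using matched_facetD(1)[OF g] .
  obtain \<sigma> where "matched_facet (insert t (V - {t})) (insert t g) \<sigma>" "\<sigma> t = z"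
  proof (rule matched_facet_insert[OF g, of "V - {t}" t z])
    show "{w \<in> W. \<not> E t w} \<subseteq> V - {t}" using t unfolding W_def by blast
    show "dominates g u \<or> E t u" if "u \<in> V - {t} - {w \<in> W. \<not> E t w}" for u
    proof -
      have "u = z \<or> E z u \<or> E t u" "u \<in> V" "u \<noteq> t" using that unfolding W_def by auto
      then show ?thesis using cliqueD(2)[OF z(2), of t u] t sym[OF t(2)] by auto
    qed
    show "t \<in> V - (V - {t})" using t by blast
    show "\<not> dominates g t" "\<not> dominates g z"
      using gW sym unfolding dominates_def W_def by blast+
    show "z \<in> V - {t}" using z t irrefl by blast
    show "z \<in> V - {w \<in> W. \<not> E t w}" using z unfolding W_def by blast
  qed (use t in auto)
  moreover have "insert t (V - {t}) = V" using t by blast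
  ultimately show ?thesis using that by (metis insertI1)
qed

text \<open>The component of \<open>x\<close> has empty boundary and so contains a simplicial
  \<open>z\<close>, with one neighbour \<open>t\<close>. A further neighbour \<open>v\<close> of
  \<open>t\<close> would see all neighbours of \<open>z\<close>, against \<open>stiff\<close>; hence
  the component is \<open>{z, t}\<close>.\<close>

lemma unique_neighbour:
  assumes stiff: "\<And>u v. u \<in> V \<Longrightarrow> v \<in> V \<Longrightarrow> u \<noteq> v \<Longrightarrow> \<exists>x\<in>V. E u x \<and> \<not> E v x"
    and nonisolated: "\<And>u. u \<in> V \<Longrightarrow> \<exists>v\<in>V. E u v"
    and simplicial: "\<And>z s t. z \<in> V \<Longrightarrow> clique {v \<in> V. E z v} \<Longrightarrow> s \<in> V \<Longrightarrow> t \<in> V \<Longrightarrow>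
      E z s \<Longrightarrow> E z t \<Longrightarrow> s = t"
    and "x \<in> V"
  shows "\<exists>y\<in>V. \<forall>v\<in>V. E x v \<longleftrightarrow> v = y"
proof -
  obtain Y where Y: "component Y V" "x \<in> Y"
    using component_exists[OF subset_refl assms(4)] by blast
  have sep: "separated Y (V - Y)" "connected_set Y" "Y \<subseteq> V" using Y unfolding component_def by auto
  then have "boundary Y = {}" unfolding boundary_def separated_def by blast
  then have "clique (boundary Y)" by (simp add: clique_def)
  then obtain z where z: "z \<in> Y" "clique {v \<in> V. E z v}"
    using simplicial_vertex_exists[OF sep(3,2)] by blast
  then have zV: "z \<in> V" using sep by blast
  then obtain t where t: "t \<in> V" "E z t" using nonisolated by blast
  have Nz: "E z v \<longleftrightarrow> v = t" if "v \<in> V" for v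
    using simplicial[OF zV z(2)] t that by blast
  have Nt: "E t v \<longleftrightarrow> v = z" if v: "v \<in> V" for v
  proof
    assume "E t v"
    show "v = z"
    proof (rule ccontr)
      assume "v \<noteq> z"
      then have "\<exists>y\<in>V. E z y \<and> \<not> E v y" using stiff[of z v] zV v by simp
      with Nz \<open>E t v\<close> sym show False by blast
    qed
  next
    assume "v = z" then show "E t v" using t sym by blast
  qed
  have "t \<in> Y" using t z sep(1) unfolding separated_def by blast
  have "separated {z, t} (Y - {z, t})"
    using Nz Nt sep(3) unfolding separated_def by blast
  moreover have "Y = {z, t} \<union> (Y - {z, t})" using \<open>t \<in> Y\<close> z by blast
  ultimately have "Y - {z, t} = {}" using sep(2) unfolding connected_set_def by blast
  then have "x = z \<or> x = t" using Y by blast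
  then show ?thesis using Nz Nt t zV by blast
qed

end

section \<open>Maps between spheres and independence complexes\<close>

text \<open>The identity on the reduced homology of the \<open>n\<close>-sphere in degree
  \<open>n\<close> factors through that of \<open>X\<close>, which vanishes unless
  \<open>n = m\<close>.\<close>

lemma homotopy_sphere_retract_dim:
  assumes X: "X homotopy_equivalent_space nsphere m"
    and i: "continuous_map (nsphere n) X i" and q: "continuous_map X (nsphere n) q"
    and qi: "homotopic_with (\<lambda>_. True) (nsphere n) (nsphere n) (q \<circ> i) id"
  shows "n = m"
proof (rule ccontr)
  assume "n \<noteq> m"
  let ?H = "\<lambda>Y. reduced_homology_group (int n) Y"
  have "?H X \<cong> ?H (nsphere m)"
    using homotopy_equivalent_space_imp_isomorphic_reduced_homology_groups[OF X] .
  moreover have "trivial_group (?H (nsphere m))"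
    using \<open>n \<noteq> m\<close> by (simp add: trivial_reduced_homology_group_nsphere)
  ultimately have triv: "trivial_group (?H X)"
    using isomorphic_group_triviality[of "?H X" "?H (nsphere m)"] by simp
  interpret i: group_hom "?H (nsphere n)" "?H X" "hom_induced n (nsphere n) {} X {} i"
    by (simp add: group_hom_def group_hom_axioms_def hom_induced_reduced_hom)
  interpret q: group_hom "?H X" "?H (nsphere n)" "hom_induced n X {} (nsphere n) {} q"
    by (simp add: group_hom_def group_hom_axioms_def hom_induced_reduced_hom)
  have "c = \<one>\<^bsub>?H (nsphere n)\<^esub>" if c: "c \<in> carrier (?H (nsphere n))" for c
  proof -
    have "c = hom_induced n (nsphere n) {} (nsphere n) {} id c"
      using c carrier_reduced_homology_group_subset[of n "nsphere n"] by (simp add: hom_induced_id subset_iff)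
    also have "\<dots> = hom_induced n (nsphere n) {} (nsphere n) {} (q \<circ> i) c"
      using homology_homotopy_empty[OF qi] by simp
    also have "\<dots> = hom_induced n X {} (nsphere n) {} q (hom_induced n (nsphere n) {} X {} i c)"
      using hom_induced_compose_empty[OF i q] by simp
    also have "hom_induced n (nsphere n) {} X {} i c = \<one>\<^bsub>?H X\<^esub>"
      using i.hom_closed[OF c] triv unfolding trivial_group_def by blast
    finally show ?thesis by simp
  qed
  then have "trivial_group (?H (nsphere n))"
    unfolding trivial_group_def using i.G.one_closed by auto
  then show False by (simp add: trivial_reduced_homology_group_nsphere)
qed

text \<open>Through the equivalence, the degree of \<open>r \<circ> j\<close> is a factor depending
  on \<open>r\<close> times a factor depending on \<open>j\<close>. Degree one for both given pairs
  makes all four factors nonzero.\<close>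

lemma homotopy_sphere_cross_degree:
  assumes X: "X homotopy_equivalent_space nsphere n"
    and i: "continuous_map (nsphere n) X i" and q: "continuous_map X (nsphere n) q"
    and i': "continuous_map (nsphere n) X i'" and q': "continuous_map X (nsphere n) q'"
    and qi: "homotopic_with (\<lambda>_. True) (nsphere n) (nsphere n) (q \<circ> i) id"
    and qi': "homotopic_with (\<lambda>_. True) (nsphere n) (nsphere n) (q' \<circ> i') id"
  shows "Brouwer_degree2 n (q \<circ> i') \<noteq> 0"
proof -
  obtain h g where h: "continuous_map X (nsphere n) h" and g: "continuous_map (nsphere n) X g"
    and gh: "homotopic_with (\<lambda>_. True) X X (g \<circ> h) id"
    using X unfolding homotopy_equivalent_space_def by blast
  have deg: "Brouwer_degree2 n (r \<circ> j) = Brouwer_degree2 n (r \<circ> g) * Brouwer_degree2 n (h \<circ> j)"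
    if j: "continuous_map (nsphere n) X j" and r: "continuous_map X (nsphere n) r" for j r
  proof -
    have "homotopic_with (\<lambda>_. True) (nsphere n) X ((g \<circ> h) \<circ> j) (id \<circ> j)"
      by (rule homotopic_with_compose_continuous_map_right[OF gh j]) simp
    then have "homotopic_with (\<lambda>_. True) (nsphere n) (nsphere n) (r \<circ> ((g \<circ> h) \<circ> j)) (r \<circ> (id \<circ> j))"
      by (rule homotopic_with_compose_continuous_map_left[OF _ r]) simp
    then have "Brouwer_degree2 n (r \<circ> j) = Brouwer_degree2 n ((r \<circ> g) \<circ> (h \<circ> j))"
      by (metis Brouwer_degree2_homotopic comp_assoc id_comp)
    also have "\<dots> = Brouwer_degree2 n (r \<circ> g) * Brouwer_degree2 n (h \<circ> j)"
      using h g j r by (intro Brouwer_degree2_compose) (auto intro: continuous_map_compose)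
    finally show ?thesis .
  qed
  have "Brouwer_degree2 n (q \<circ> i) = 1" "Brouwer_degree2 n (q' \<circ> i') = 1"
    using Brouwer_degree2_homotopic[OF qi] Brouwer_degree2_homotopic[OF qi'] by auto
  with deg[OF i q] deg[OF i' q'] deg[OF i' q] show ?thesis by auto
qed

section \<open>Radial projection to the sphere\<close>

definition sphere_normalize :: "nat \<Rightarrow> (nat \<Rightarrow> real) \<Rightarrow> nat \<Rightarrow> real" where
  "sphere_normalize n w = (\<lambda>i. if i \<le> n then w i / sqrt (\<Sum>j\<le>n. (w j)\<^sup>2) else 0)"

lemma sum_squares_pos:
  fixes w :: "nat \<Rightarrow> real"
  assumes "i \<le> n" "w i \<noteq> 0"
  shows "0 < (\<Sum>j\<le>n. (w j)\<^sup>2)"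
  using assms by (intro sum_pos2[of _ i]) auto

text \<open>The second hypothesis keeps the norm positive. Cutting off beyond index \<open>n\<close>
  agrees with \<open>nsphere n\<close>, whose points vanish there.\<close>

lemma continuous_map_sphere_normalize:
  assumes w: "\<And>i. i \<le> n \<Longrightarrow> continuous_map X euclideanreal (\<lambda>x. w x i)"
    and nz: "\<And>x. x \<in> topspace X \<Longrightarrow> \<exists>i\<le>n. w x i \<noteq> 0"
  shows "continuous_map X (nsphere n) (\<lambda>x. sphere_normalize n (w x))"
proof -
  have pos: "0 < (\<Sum>j\<le>n. (w x j)\<^sup>2)" if "x \<in> topspace X" for x
    using nz[OF that] sum_squares_pos by blast
  have "continuous_map X (powertop_real UNIV) (\<lambda>x. sphere_normalize n (w x))"
    unfolding continuous_map_componentwise_UNIV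
  proof
    fix i
    show "continuous_map X euclideanreal (\<lambda>x. sphere_normalize n (w x) i)"
    proof (cases "i \<le> n")
      case True
      have "continuous_map X euclideanreal (\<lambda>x. w x i / sqrt (\<Sum>j\<le>n. (w x j)\<^sup>2))"
        using pos w True by (intro continuous_intros) (force+)
      then show ?thesis using True by (simp add: sphere_normalize_def)
    qed (simp add: sphere_normalize_def)
  qed
  moreover have "(\<Sum>i\<le>n. (sphere_normalize n (w x) i)\<^sup>2) = 1" if "x \<in> topspace X" for x
  proof -
    have "(\<Sum>i\<le>n. (sphere_normalize n (w x) i)\<^sup>2) = (\<Sum>i\<le>n. (w x i)\<^sup>2 / (\<Sum>j\<le>n. (w x j)\<^sup>2))"
      using pos[OF that] by (intro sum.cong) (auto simp: sphere_normalize_def power_divide)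
    also have "\<dots> = 1" using pos[OF that] by (simp add: sum_divide_distrib[symmetric])
    finally show ?thesis .
  qed
  ultimately show ?thesis
    unfolding nsphere continuous_map_in_subtopology
    by (auto simp: sphere_normalize_def)
qed

lemma sphere_normalize_id:
  assumes "y \<in> topspace (nsphere n)"
  shows "sphere_normalize n y = y"
  using assms by (auto simp: nsphere sphere_normalize_def fun_eq_iff)

text \<open>The straight-line homotopy avoids the origin by hypothesis, so it can be projected
  radially.\<close>

lemma homotopic_sphere_normalize_id:
  assumes w: "\<And>i. i \<le> n \<Longrightarrow> continuous_map (nsphere n) euclideanreal (\<lambda>y. w y i)"
    and nz: "\<And>y t. y \<in> topspace (nsphere n) \<Longrightarrow> 0 \<le> t \<Longrightarrow> t \<le> 1 \<Longrightarrow>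
      \<exists>i\<le>n. (1 - t) * w y i + t * y i \<noteq> 0"
  shows "homotopic_with (\<lambda>_. True) (nsphere n) (nsphere n) (\<lambda>y. sphere_normalize n (w y)) id"
proof -
  let ?I = "top_of_set {0..1::real}"
  let ?h = "\<lambda>z. sphere_normalize n (\<lambda>i. (1 - fst z) * w (snd z) i + fst z * snd z i)"
  have f: "continuous_map (prod_topology ?I (nsphere n)) euclideanreal (\<lambda>z. fst z)"
    using continuous_map_fst[of ?I "nsphere n"] continuous_map_into_fulltopology by blast
  have s: "continuous_map (prod_topology ?I (nsphere n)) euclideanreal (\<lambda>z. F (snd z))"
    if "continuous_map (nsphere n) euclideanreal F" for F
    using continuous_map_compose[OF continuous_map_snd that] by (simp add: o_def)
  have "continuous_map (prod_topology ?I (nsphere n)) (nsphere n) ?h"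
  proof (rule continuous_map_sphere_normalize)
    fix i assume "i \<le> n"
    show "continuous_map (prod_topology ?I (nsphere n)) euclideanreal
        (\<lambda>z. (1 - fst z) * w (snd z) i + fst z * snd z i)"
      using s[OF w[OF \<open>i \<le> n\<close>]] s[OF continuous_map_nsphere_projection[of n i]] f
      by (intro continuous_intros)
  next
    fix z assume "z \<in> topspace (prod_topology ?I (nsphere n))"
    then have "snd z \<in> topspace (nsphere n)" "0 \<le> fst z" "fst z \<le> 1" by auto
    then show "\<exists>i\<le>n. (1 - fst z) * w (snd z) i + fst z * snd z i \<noteq> 0" using nz by blast
  qed
  then show ?thesis
    by (subst homotopic_with) (auto intro!: exI[of _ ?h] simp: sphere_normalize_id)
qed

section \<open>Coordinates on geometric realizations\<close>

lemma continuous_map_realization_proj: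
  "continuous_map (geometric_realization K) euclideanreal (\<lambda>x. x v)"
  unfolding geometric_realization_def
  by (intro continuous_map_from_subtopology continuous_map_product_projection) simp

lemma continuous_map_into_realization:
  assumes "\<And>v. continuous_map Y euclideanreal (\<lambda>y. f y v)"
    and "\<And>y. y \<in> topspace Y \<Longrightarrow> f y \<in> topspace (geometric_realization K)"
  shows "continuous_map Y (geometric_realization K) f"
  using assms unfolding geometric_realization_def continuous_map_in_subtopology
  by (auto simp: continuous_map_componentwise_UNIV)

text \<open>The standard map from the sphere to the boundary of the cross-polytope: positive parts
  become weights of the facet, negative parts weights of the partners, and the l1 norm makes the
  total one.\<close>

definition cross_point :: "nat \<Rightarrow> (nat \<Rightarrow> 'a) \<Rightarrow> ('a \<Rightarrow> 'a) \<Rightarrow> (nat \<Rightarrow> real) \<Rightarrow> 'a \<Rightarrow> real" where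
  "cross_point n e \<pi> y v =
     (\<Sum>i\<le>n. (if v = e i then max (y i) 0 else 0) + (if v = \<pi> (e i) then max (- y i) 0 else 0)) /
     (\<Sum>i\<le>n. \<bar>y i\<bar>)"

lemma sum_abs_pos_nsphere:
  assumes "y \<in> topspace (nsphere n)"
  shows "0 < (\<Sum>i\<le>n. \<bar>y i\<bar>)"
proof (rule ccontr)
  assume "\<not> ?thesis"
  then have "(\<Sum>i\<le>n. \<bar>y i\<bar>) = 0" by (metis abs_ge_zero sum_nonneg order_le_less)
  then have "\<forall>i\<le>n. y i = 0" by (simp add: sum_nonneg_eq_0_iff)
  then show False using assms by (simp add: nsphere)
qed

lemma cross_point_nonzero:
  assumes "cross_point n e \<pi> y v \<noteq> 0"
  shows "\<exists>i\<le>n. v = e i \<and> 0 < y i \<or> v = \<pi> (e i) \<and> y i < 0"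
proof (rule ccontr)
  assume a: "\<not> ?thesis"
  then have "(if v = e i then max (y i) 0 else 0) + (if v = \<pi> (e i) then max (- y i) 0 else 0) = 0"
    if "i \<le> n" for i
    using that by force
  then show False using assms by (simp add: cross_point_def)
qed

lemma enum_exists:
  fixes F :: "'a set"
  assumes "finite F" "F \<noteq> {}"
  obtains n and e :: "nat \<Rightarrow> 'a" where "bij_betw e {..n} F" "card F = Suc n"
proof -
  obtain n where n: "card F = Suc n" using assms by (metis card_gt_0_iff gr0_implies_Suc)
  then show ?thesis
    using that ex_bij_betw_nat_finite[OF assms(1)] by (metis atLeast0LessThan lessThan_Suc_atMost)
qed

section \<open>The two maps attached to a matched facet\<close>

context finite_graph begin

definition ind_complex :: "'a set set" where
  "ind_complex = {\<sigma>. \<sigma> \<subseteq> V \<and> (\<forall>u\<in>\<sigma>. \<forall>v\<in>\<sigma>. \<not> E u v)}"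

lemma in_realization_iff:
  "x \<in> topspace (geometric_realization ind_complex) \<longleftrightarrow>
     (\<forall>v. 0 \<le> x v) \<and> (\<forall>v. v \<notin> V \<longrightarrow> x v = 0) \<and> (\<forall>u v. E u v \<longrightarrow> x u = 0 \<or> x v = 0) \<and>
     (\<Sum>v\<in>V. x v) = 1"
proof -
  have "(\<Sum>v | x v \<noteq> 0. x v) = (\<Sum>v\<in>V. x v)" if "{v. x v \<noteq> 0} \<subseteq> V"
    using that finite_V by (intro sum.mono_neutral_left) auto
  moreover have "{v. x v \<noteq> 0} \<subseteq> V \<longleftrightarrow> (\<forall>v. v \<notin> V \<longrightarrow> x v = 0)" by blast
  ultimately show ?thesis
    unfolding geometric_realization_def ind_complex_def by auto
qed

text \<open>Subtracting the weight off \<open>F\<close> from every coordinate makes coordinate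
  \<open>i\<close> positive only where \<open>e i\<close> has positive weight. After normalization
  this realizes the collapse of everything but the open facet up to homotopy.\<close>

definition facet_coord :: "'a set \<Rightarrow> (nat \<Rightarrow> 'a) \<Rightarrow> ('a \<Rightarrow> real) \<Rightarrow> nat \<Rightarrow> real" where
  "facet_coord F e x i = x (e i) - (\<Sum>u\<in>V - F. x u)"

lemma matched_facet_enum:
  assumes F: "matched_facet V F \<pi>" and e: "bij_betw e {..n} F" and ij: "i \<le> n" "j \<le> n"
  shows "e i \<in> V" "\<pi> (e i) \<in> V" "e i = e j \<longleftrightarrow> i = j" "e i \<noteq> \<pi> (e j)"
    "\<pi> (e i) = \<pi> (e j) \<longleftrightarrow> i = j" "\<not> E (e i) (e j)" "E (e i) (\<pi> (e j)) \<longleftrightarrow> i = j"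
    "\<not> E (\<pi> (e i)) (\<pi> (e j))"
proof -
  note D = matched_facetD[OF F]
  have eF: "e i \<in> F" "e j \<in> F" using e ij by (auto simp: bij_betw_def)
  show eq: "e i = e j \<longleftrightarrow> i = j" using e ij by (auto simp: bij_betw_def inj_on_def)
  show "e i \<in> V" "\<pi> (e i) \<in> V" using D(1,2) eF by auto
  show ee: "\<not> E (e i) (e j)"
    using D(5)[OF eF] irrefl by (cases "e i = e j") auto
  show ep: "E (e i) (\<pi> (e j)) \<longleftrightarrow> i = j"
    using D(4)[OF eF(2)] D(6)[OF eF(2,1)] eq sym_iff[of "e i"] by metis
  show "\<not> E (\<pi> (e i)) (\<pi> (e j))"
    using D(7)[OF eF] irrefl by (cases "e i = e j") auto
  show "e i \<noteq> \<pi> (e j)"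
    using ee ep D(4)[OF eF(1)] irrefl sym_iff[of "e j"] D(4)[OF eF(2)] by metis
  show "\<pi> (e i) = \<pi> (e j) \<longleftrightarrow> i = j"
    using ep D(4)[OF eF(1)] by metis
qed

lemma cross_point_at:
  assumes F: "matched_facet V F \<pi>" and e: "bij_betw e {..n} F" and k: "k \<le> n"
  shows "cross_point n e \<pi> y (e k) = max (y k) 0 / (\<Sum>i\<le>n. \<bar>y i\<bar>)"
    "cross_point n e \<pi> y (\<pi> (e k)) = max (- y k) 0 / (\<Sum>i\<le>n. \<bar>y i\<bar>)"
proof -
  note D = matched_facet_enum[OF F e]
  have "(\<Sum>i\<le>n. (if e k = e i then max (y i) 0 else 0) + (if e k = \<pi> (e i) then max (- y i) 0 else 0)) =
      (\<Sum>i\<le>n. if k = i then max (y i) 0 else 0)"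
    using k by (intro sum.cong) (simp_all add: D)
  then show "cross_point n e \<pi> y (e k) = max (y k) 0 / (\<Sum>i\<le>n. \<bar>y i\<bar>)"
    using k by (simp add: cross_point_def)
  have "(\<Sum>i\<le>n. (if \<pi> (e k) = e i then max (y i) 0 else 0) + (if \<pi> (e k) = \<pi> (e i) then max (- y i) 0 else 0)) =
      (\<Sum>i\<le>n. if k = i then max (- y i) 0 else 0)"
    using k by (intro sum.cong) (simp_all add: D D(4)[symmetric])
  then show "cross_point n e \<pi> y (\<pi> (e k)) = max (- y k) 0 / (\<Sum>i\<le>n. \<bar>y i\<bar>)"
    using k by (simp add: cross_point_def)
qed

lemma cross_point_in_realization:
  assumes F: "matched_facet V F \<pi>" and e: "bij_betw e {..n} F" and y: "y \<in> topspace (nsphere n)"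
  shows "cross_point n e \<pi> y \<in> topspace (geometric_realization ind_complex)"
  unfolding in_realization_iff
proof (intro conjI allI impI)
  note D = matched_facet_enum[OF F e]
  let ?N = "\<Sum>i\<le>n. \<bar>y i\<bar>"
  have N: "0 < ?N" using sum_abs_pos_nsphere[OF y] .
  show "0 \<le> cross_point n e \<pi> y v" for v
    unfolding cross_point_def by (intro divide_nonneg_pos sum_nonneg N) auto
  show "cross_point n e \<pi> y v = 0" if "v \<notin> V" for v
    using cross_point_nonzero[of n e \<pi> y v] D(1,2) that by metis
  show "cross_point n e \<pi> y u = 0 \<or> cross_point n e \<pi> y v = 0" if uv: "E u v" for u v
  proof (rule ccontr)
    assume "\<not> ?thesis"
    then have nz: "cross_point n e \<pi> y u \<noteq> 0" "cross_point n e \<pi> y v \<noteq> 0" by simp_all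
    obtain i where i: "i \<le> n" "u = e i \<and> 0 < y i \<or> u = \<pi> (e i) \<and> y i < 0"
      using cross_point_nonzero[OF nz(1)] by (elim exE conjE)
    obtain j where j: "j \<le> n" "v = e j \<and> 0 < y j \<or> v = \<pi> (e j) \<and> y j < 0"
      using cross_point_nonzero[OF nz(2)] by (elim exE conjE)
    show False
      using i j D(6)[of i j] D(7)[of i j] D(7)[of j i] D(8)[of i j] uv sym_iff[of u v] by auto
  qed
  have "(\<Sum>v\<in>V. cross_point n e \<pi> y v) =
      (\<Sum>v\<in>V. \<Sum>i\<le>n. (if v = e i then max (y i) 0 else 0) + (if v = \<pi> (e i) then max (- y i) 0 else 0)) / ?N"
    by (simp add: cross_point_def sum_divide_distrib)
  also have "(\<Sum>v\<in>V. \<Sum>i\<le>n. (if v = e i then max (y i) 0 else 0) + (if v = \<pi> (e i) then max (- y i) 0 else 0)) =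
      (\<Sum>i\<le>n. \<Sum>v\<in>V. (if v = e i then max (y i) 0 else 0) + (if v = \<pi> (e i) then max (- y i) 0 else 0))"
    by (rule sum.swap)
  also have "\<dots> = (\<Sum>i\<le>n. max (y i) 0 + max (- y i) 0)"
    using D(1,2) finite_V by (intro sum.cong) (auto simp: sum.distrib)
  also have "\<dots> = ?N" by (intro sum.cong) auto
  finally show "(\<Sum>v\<in>V. cross_point n e \<pi> y v) = 1" using N by simp
qed

lemma continuous_map_cross_point:
  assumes F: "matched_facet V F \<pi>" and e: "bij_betw e {..n} F"
  shows "continuous_map (nsphere n) (geometric_realization ind_complex) (cross_point n e \<pi>)"
proof (rule continuous_map_into_realization)
  fix v
  have *: "continuous_map (nsphere n) euclideanreal (\<lambda>y. if P then f y else 0)"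
    if "continuous_map (nsphere n) euclideanreal f" for P f
    using that by simp
  show "continuous_map (nsphere n) euclideanreal (\<lambda>y. cross_point n e \<pi> y v)"
    unfolding cross_point_def
    using sum_abs_pos_nsphere
    by (intro continuous_intros * continuous_map_nsphere_projection) force+
qed (use cross_point_in_realization[OF F e] in simp)

text \<open>If all coordinates vanish, each vertex of \<open>F\<close> carries the total weight off
  \<open>F\<close>. This is not zero, as the weights sum to one; but then a vertex outside
  \<open>F\<close> shares a face with its neighbour in \<open>F\<close>.\<close>

lemma facet_coord_nonzero:
  assumes F: "matched_facet V F \<pi>" and e: "bij_betw e {..n} F"
    and x: "x \<in> topspace (geometric_realization ind_complex)"
  shows "\<exists>i\<le>n. facet_coord F e x i \<noteq> 0"
proof (rule ccontr)
  assume "\<not> ?thesis"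
  then have a: "x (e i) = (\<Sum>u\<in>V - F. x u)" if "i \<le> n" for i
    using that by (simp add: facet_coord_def)
  note x = x[unfolded in_realization_iff]
  have xF: "x w = (\<Sum>u\<in>V - F. x u)" if "w \<in> F" for w
  proof -
    have "w \<in> e ` {..n}" using that by (simp only: bij_betw_imp_surj_on[OF e])
    then obtain i where "i \<le> n" "w = e i" by (elim imageE) simp
    then show ?thesis using a by simp
  qed
  have FV: "F \<subseteq> V" using matched_facetD(1)[OF F] .
  have sum: "(\<Sum>v\<in>V. x v) = (\<Sum>v\<in>V - F. x v) + (\<Sum>v\<in>F. x v)"
    using sum.subset_diff[OF FV finite_V] .
  show False
  proof (cases "\<forall>u\<in>V - F. x u = 0")
    case True
    then show False using sum xF x by simp
  next
    case False
    then obtain u where u: "u \<in> V - F" "x u \<noteq> 0" by blast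
    then obtain w where w: "w \<in> F" "E w u" using matched_facetD(3)[OF F] unfolding dominates_def by blast
    have "0 < (\<Sum>u\<in>V - F. x u)"
      using u x finite_V by (intro sum_pos2[of _ u]) (auto simp: order_less_le)
    then have "x w \<noteq> 0" using xF w by simp
    then show False using x w u by blast
  qed
qed

lemma continuous_map_facet:
  assumes F: "matched_facet V F \<pi>" and e: "bij_betw e {..n} F"
  shows "continuous_map (geometric_realization ind_complex) (nsphere n)
    (\<lambda>x. sphere_normalize n (facet_coord F e x))"
proof (rule continuous_map_sphere_normalize)
  show "continuous_map (geometric_realization ind_complex) euclideanreal (\<lambda>x. facet_coord F e x i)" for i
    unfolding facet_coord_def
    using finite_V by (intro continuous_intros continuous_map_realization_proj) auto
qed (use facet_coord_nonzero[OF F e] in simp)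

text \<open>The weight off \<open>F\<close> is one minus the weight on \<open>F\<close>, which
  leaves the normalized negative parts of \<open>y\<close>.\<close>

lemma facet_coord_cross_point:
  assumes F: "matched_facet V F \<pi>" and e: "bij_betw e {..n} F" and y: "y \<in> topspace (nsphere n)"
    and k: "k \<le> n"
  shows "facet_coord F e (cross_point n e \<pi> y) k =
    (max (y k) 0 - (\<Sum>i\<le>n. max (- y i) 0)) / (\<Sum>i\<le>n. \<bar>y i\<bar>)"
proof -
  let ?x = "cross_point n e \<pi> y" and ?N = "\<Sum>i\<le>n. \<bar>y i\<bar>"
  have N: "0 < ?N" using sum_abs_pos_nsphere[OF y] .
  have FV: "F \<subseteq> V" using matched_facetD(1)[OF F] .
  have "(\<Sum>v\<in>F. ?x v) = (\<Sum>i\<le>n. ?x (e i))" using sum.reindex_bij_betw[OF e] by metis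
  also have "\<dots> = (\<Sum>i\<le>n. max (y i) 0) / ?N"
    by (simp add: cross_point_at(1)[OF F e] sum_divide_distrib)
  finally have 1: "(\<Sum>v\<in>F. ?x v) = (\<Sum>i\<le>n. max (y i) 0) / ?N" .
  have "?N = (\<Sum>i\<le>n. max (y i) 0 + max (- y i) 0)" by (intro sum.cong) auto
  then have 2: "?N = (\<Sum>i\<le>n. max (y i) 0) + (\<Sum>i\<le>n. max (- y i) 0)" by (simp add: sum.distrib)
  have "(\<Sum>v\<in>V. ?x v) = 1"
    using cross_point_in_realization[OF F e y] unfolding in_realization_iff by simp
  then have "(\<Sum>v\<in>V - F. ?x v) = 1 - (\<Sum>i\<le>n. max (y i) 0) / ?N"
    using sum.subset_diff[OF FV finite_V, of ?x] 1 by simp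
  also have "\<dots> = (\<Sum>i\<le>n. max (- y i) 0) / ?N"
    using 2 N by (simp add: divide_simps)
  finally show ?thesis
    by (simp add: facet_coord_def cross_point_at(1)[OF F e k] diff_divide_distrib)
qed

text \<open>The straight line to the identity avoids zero: at a negative coordinate of
  \<open>y\<close> both ends are negative, and if there is none, the composite merely rescales
  \<open>y\<close>.\<close>

lemma homotopic_facet_cross_point:
  assumes F: "matched_facet V F \<pi>" and e: "bij_betw e {..n} F"
  shows "homotopic_with (\<lambda>_. True) (nsphere n) (nsphere n)
    ((\<lambda>x. sphere_normalize n (facet_coord F e x)) \<circ> cross_point n e \<pi>) id"
  unfolding o_def
proof (rule homotopic_sphere_normalize_id)
  have c: "continuous_map (nsphere n) euclideanreal (\<lambda>y. cross_point n e \<pi> y v)" for v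
    using continuous_map_compose[OF continuous_map_cross_point[OF F e] continuous_map_realization_proj]
    by (simp add: o_def)
  show "continuous_map (nsphere n) euclideanreal (\<lambda>y. facet_coord F e (cross_point n e \<pi> y) i)" for i
    unfolding facet_coord_def using finite_V by (intro continuous_intros c) auto
  fix y and t :: real assume y: "y \<in> topspace (nsphere n)" and t: "0 \<le> t" "t \<le> 1"
  let ?N = "\<Sum>i\<le>n. \<bar>y i\<bar>"
  define S where "S = (\<Sum>i\<le>n. max (- y i) 0)"
  define b where "b = (1 - t) / ?N"
  have N: "0 < ?N" using sum_abs_pos_nsphere[OF y] .
  have b: "0 \<le> b" using N t by (simp add: b_def)
  have tb: "t \<noteq> 0 \<or> b \<noteq> 0" using N by (simp add: b_def)
  show "\<exists>i\<le>n. (1 - t) * facet_coord F e (cross_point n e \<pi> y) i + t * y i \<noteq> 0"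
  proof (rule ccontr)
    assume neg: "\<not> ?thesis"
    have z: "b * (max (y i) 0 - S) + t * y i = 0" if "i \<le> n" for i
    proof -
      have "(1 - t) * ((max (y i) 0 - S) / ?N) + t * y i = 0"
        unfolding S_def facet_coord_cross_point[OF F e y that, symmetric] using neg that by blast
      then show ?thesis by (simp add: b_def)
    qed
    have S0: "0 \<le> S" unfolding S_def by (intro sum_nonneg) simp
    show False
    proof (cases "S = 0")
      case True
      then have "0 \<le> y i" if "i \<le> n" for i
        using that unfolding S_def by (subst (asm) sum_nonneg_eq_0_iff) (auto simp: max_def split: if_splits)
      then have "(b + t) * y i = 0" if "i \<le> n" for i
        using z[OF that] that True by (simp add: algebra_simps)
      moreover have "b + t \<noteq> 0" using tb b t by linarith
      ultimately have "y i = 0" if "i \<le> n" for i using that by auto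
      then show False using y by (simp add: nsphere)
    next
      case False
      have "\<exists>i\<le>n. y i < 0"
      proof (rule ccontr)
        assume "\<not> ?thesis"
        then have "S = 0" unfolding S_def by (intro sum.neutral) (auto simp: not_less)
        with False show False ..
      qed
      then obtain i where i: "i \<le> n" "y i < 0" by blast
      then have "b * S + t * (- y i) = 0" using z[OF i(1)] by (simp add: max_def)
      moreover have "0 \<le> b * S" "0 \<le> t * (- y i)" using b S0 t i by (auto intro: mult_nonneg_nonneg simp: mult_nonneg_nonpos)
      ultimately have "b * S = 0" "t * (- y i) = 0" by linarith+
      then show False using tb False i by auto
    qed
  qed
qed

section \<open>Comparison of matched facets\<close>

lemma matched_facet_card:
  assumes F: "matched_facet V F \<pi>" "F \<noteq> {}"
    and X: "geometric_realization ind_complex homotopy_equivalent_space nsphere m"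
  shows "card F = Suc m"
proof -
  have "finite F" using matched_facetD(1)[OF F(1)] finite_V finite_subset by blast
  then obtain n and e :: "nat \<Rightarrow> 'a" where e: "bij_betw e {..n} F" "card F = Suc n"
    using enum_exists F(2) by blast
  then show ?thesis
    using homotopy_sphere_retract_dim[OF X continuous_map_cross_point[OF F(1) e(1)]
        continuous_map_facet[OF F(1) e(1)] homotopic_facet_cross_point[OF F(1) e(1)]] by simp
qed

text \<open>If \<open>w\<close> is missed, the cross-polytope of \<open>F'\<close> followed by the
  collapse for \<open>F\<close> misses a point of the sphere and has degree zero, against
  \<open>homotopy_sphere_cross_degree\<close>.\<close>

lemma matched_facet_subset:
  assumes F: "matched_facet V F \<pi>" "F \<noteq> {}" and F': "matched_facet V F' \<pi>'" "F' \<noteq> {}"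
    and X: "geometric_realization ind_complex homotopy_equivalent_space nsphere n"
  shows "F \<subseteq> F' \<union> \<pi>' ` F'"
proof
  fix w assume w: "w \<in> F"
  have "finite F" "finite F'"
    using matched_facetD(1)[OF F(1)] matched_facetD(1)[OF F'(1)] finite_V finite_subset by blast+
  then obtain e e' where e: "bij_betw e {..n} F" and e': "bij_betw e' {..n} F'"
    using enum_exists F(2) F'(2) matched_facet_card[OF F X] matched_facet_card[OF F' X]
    by (metis nat.inject)
  let ?q = "\<lambda>x. sphere_normalize n (facet_coord F e x)"
  let ?f = "?q \<circ> cross_point n e' \<pi>'"
  show "w \<in> F' \<union> \<pi>' ` F'"
  proof (rule ccontr)
    assume n: "w \<notin> F' \<union> \<pi>' ` F'"
    have "w \<in> e ` {..n}" using w by (simp only: bij_betw_imp_surj_on[OF e])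
    then obtain k where k: "k \<le> n" "w = e k" by (elim imageE) simp
    \<comment> \<open>This unit vector can only be hit by a point with positive weight at
      \<open>w\<close>.\<close>
    define p :: "nat \<Rightarrow> real" where "p = (\<lambda>i. if i = k then 1 else 0)"
    have "p \<in> topspace (nsphere n)"
      using k by (auto simp: nsphere p_def if_distrib[of "\<lambda>x. x\<^sup>2"] cong: if_cong)
    moreover have "?f y \<noteq> p" if y: "y \<in> topspace (nsphere n)" for y
    proof
      assume a: "?f y = p"
      let ?x = "cross_point n e' \<pi>' y"
      have "?x \<in> topspace (geometric_realization ind_complex)"
        using cross_point_in_realization[OF F'(1) e' y] .
      then have "0 \<le> (\<Sum>u\<in>V - F. ?x u)" unfolding in_realization_iff by (simp add: sum_nonneg)
      moreover have "?x w = 0"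
        using cross_point_nonzero[of n e' \<pi>' y w] n e' by (auto simp: bij_betw_def)
      ultimately have "facet_coord F e ?x k \<le> 0" using k by (simp add: facet_coord_def)
      then have "?f y k \<le> 0"
        using k by (simp add: sphere_normalize_def divide_nonpos_nonneg sum_nonneg)
      then show False unfolding a p_def by simp
    qed
    ultimately have "?f ` topspace (nsphere n) \<noteq> topspace (nsphere n)" by (metis imageE)
    moreover have "continuous_map (nsphere n) (nsphere n) ?f"
      using continuous_map_compose[OF continuous_map_cross_point[OF F'(1) e'] continuous_map_facet[OF F(1) e]] .
    ultimately have "Brouwer_degree2 n ?f = 0" using Brouwer_degree2_nonsurjective by blast
    then show False
      using homotopy_sphere_cross_degree[OF X continuous_map_cross_point[OF F(1) e]
          continuous_map_facet[OF F(1) e] continuous_map_cross_point[OF F'(1) e']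
          continuous_map_facet[OF F'(1) e'] homotopic_facet_cross_point[OF F(1) e]
          homotopic_facet_cross_point[OF F'(1) e']] by blast
  qed
qed

end

section \<open>Dismantlings and the core\<close>

text \<open>A cone is closed under adding its apex; applied to the link of \<open>u\<close>, this
  gives room for the homotopy that removes \<open>u\<close>.\<close>

lemma dominated_by_insert:
  assumes K: "abstract_complex K" and d: "dominated_by K u u'" and \<sigma>: "\<sigma> \<in> K" "u \<in> \<sigma>"
  shows "insert u' \<sigma> \<in> K"
proof -
  obtain B where B: "link K u = B \<union> insert u' ` B"
    using d unfolding dominated_by_def cone_with_apex_def by blast
  have ins: "insert u (\<sigma> - {u}) = \<sigma>" using \<sigma> by blast
  have "\<sigma> - {u} \<in> link K u"
    using K \<sigma> unfolding link_def abstract_complex_def by (simp add: ins)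
  then have "\<sigma> - {u} \<in> B \<or> (\<exists>\<tau>\<in>B. \<sigma> - {u} = insert u' \<tau>)" unfolding B by blast
  then have "insert u' (\<sigma> - {u}) \<in> link K u"
    unfolding B by (elim disjE bexE) (simp_all only: insert_absorb2 Un_iff image_eqI simp_thms)
  then have "insert u (insert u' (\<sigma> - {u})) \<in> K" unfolding link_def by blast
  moreover have "insert u (insert u' (\<sigma> - {u})) = insert u' \<sigma>" using \<sigma> by blast
  ultimately show ?thesis by simp
qed

lemma realization_sum:
  assumes "x \<in> topspace (geometric_realization K)" "finite S" "{v. x v \<noteq> 0} \<subseteq> S"
  shows "sum x S = 1"
proof -
  have "(\<Sum>v | x v \<noteq> 0. x v) = sum x S" using assms by (intro sum.mono_neutral_left) auto
  then show ?thesis using assms(1) by (simp add: geometric_realization_def)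
qed

text \<open>The homotopy moves the weight of \<open>u\<close> linearly to the dominating vertex.\<close>

lemma dominated_homotopy_equivalent:
  assumes K: "abstract_complex K" and "dominated K u"
  shows "geometric_realization K homotopy_equivalent_space geometric_realization (remove_vertex K u)"
proof -
  obtain u' where d: "dominated_by K u u'" using assms(2) unfolding dominated_def by blast
  then have uu': "u' \<noteq> u" unfolding dominated_by_def by blast
  define X where "X = geometric_realization K"
  define Y where "Y = geometric_realization (remove_vertex K u)"
  \<comment> \<open>Points with \<open>x u = 0\<close> stay fixed, so \<open>h 1\<close> will be a
    retraction.\<close>
  define h where "h = (\<lambda>(s::real) x v. x v + (if v = u then - s * x u else 0) + (if v = u' then s * x u else 0))"
  have X: "x \<in> topspace X \<longleftrightarrow> (\<forall>v. 0 \<le> x v) \<and> {v. x v \<noteq> 0} \<in> K \<and> (\<Sum>v | x v \<noteq> 0. x v) = 1" for x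
    by (simp add: X_def geometric_realization_def)
  have Y: "x \<in> topspace Y \<longleftrightarrow> x \<in> topspace X \<and> x u = 0" for x
    unfolding X by (auto simp: Y_def geometric_realization_def remove_vertex_def)
  have hX: "h s x \<in> topspace X" if x: "x \<in> topspace X" and s: "0 \<le> s" "s \<le> 1" for s x
  proof (cases "x u = 0")
    case True
    then have "h s x = x" by (auto simp: h_def)
    with x show ?thesis by simp
  next
    case False
    \<comment> \<open>One face contains the supports of all intermediate points: the support of
      \<open>x\<close> with the dominating vertex added.\<close>
    let ?S = "insert u' {v. x v \<noteq> 0}"
    have SK: "?S \<in> K"
      using dominated_by_insert[OF K d] x False unfolding X by simp
    then have fin: "finite ?S" using K unfolding abstract_complex_def by blast
    have sub: "{v. h s x v \<noteq> 0} \<subseteq> ?S" using False by (auto simp: h_def)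
    then have "{v. h s x v \<noteq> 0} \<in> K" using K SK unfolding abstract_complex_def by blast
    moreover have "0 \<le> h s x v" for v
    proof -
      have "s * x u \<le> x u" "0 \<le> s * x u"
        using x s unfolding X by (auto intro: mult_left_le_one_le)
      then show ?thesis using x uu' unfolding X h_def by auto
    qed
    moreover have "(\<Sum>v | h s x v \<noteq> 0. h s x v) = 1"
    proof -
      have "(\<Sum>v | h s x v \<noteq> 0. h s x v) = sum (h s x) ?S"
        using sub fin by (intro sum.mono_neutral_left) auto
      also have "\<dots> = sum x ?S + (\<Sum>v\<in>?S. if v = u then - s * x u else 0) + (\<Sum>v\<in>?S. if v = u' then s * x u else 0)"
        by (simp only: h_def sum.distrib)
      also have "(\<Sum>v\<in>?S. if v = u then - s * x u else 0) = - s * x u"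
        using fin False by (subst sum.delta) auto
      also have "(\<Sum>v\<in>?S. if v = u' then s * x u else 0) = s * x u"
        using fin by (subst sum.delta) auto
      also have "sum x ?S = 1"
        using realization_sum[of x K ?S] x fin unfolding X_def by blast
      finally show ?thesis by simp
    qed
    ultimately show ?thesis unfolding X by blast
  qed
  let ?I = "top_of_set {0..1::real}"
  have f: "continuous_map (prod_topology ?I X) euclideanreal (\<lambda>z. fst z)"
    using continuous_map_fst[of ?I X] continuous_map_into_fulltopology by blast
  have s: "continuous_map (prod_topology ?I X) euclideanreal (\<lambda>z. snd z v)" for v
    using continuous_map_compose[OF continuous_map_snd continuous_map_realization_proj]
    unfolding X_def by (simp add: o_def)
  have cont: "continuous_map (prod_topology ?I X) euclideanreal (\<lambda>z. h (fst z) (snd z) v)" for v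
  proof -
    have *: "continuous_map (prod_topology ?I X) euclideanreal (\<lambda>z. if P then g z else 0)"
      if "continuous_map (prod_topology ?I X) euclideanreal g" for P g
      using that by simp
    show ?thesis unfolding h_def by (intro continuous_intros * f s)
  qed
  have "continuous_map (prod_topology ?I X) X (\<lambda>z. h (fst z) (snd z))"
    unfolding X_def
    by (rule continuous_map_into_realization) (use cont hX in \<open>auto simp: X_def[symmetric]\<close>)
  then have "homotopic_with (\<lambda>_. True) X X id (h 1)"
    by (subst homotopic_with) (auto intro!: exI[of _ "\<lambda>z. h (fst z) (snd z)"] simp: h_def)
  then have hom: "homotopic_with (\<lambda>_. True) X X (h 1) id" by (rule homotopic_with_symD)
  have "retraction_maps X Y (h 1) id"
    unfolding retraction_maps_def
  proof (intro conjI ballI)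
    have "h 1 x u = 0" for x using uu' by (simp add: h_def)
    moreover have "continuous_map X X (h 1)"
      using homotopic_with_imp_continuous_maps[OF hom] by blast
    moreover have "continuous_map X euclideanreal (\<lambda>x. h 1 x v)" for v
      using continuous_map_compose[OF \<open>continuous_map X X (h 1)\<close>[unfolded X_def] continuous_map_realization_proj]
      unfolding X_def by (simp add: o_def)
    ultimately show "continuous_map X Y (h 1)"
      unfolding Y_def
      by (intro continuous_map_into_realization) (auto simp: Y_def[symmetric] Y hX)
    show "continuous_map Y X id"
      unfolding X_def
      by (rule continuous_map_into_realization)
        (simp_all add: Y continuous_map_realization_proj flip: X_def, simp add: Y_def continuous_map_realization_proj)
    show "h 1 (id x) = x" if "x \<in> topspace Y" for x
      using that unfolding Y h_def by auto
  qed
  then have "X homotopy_equivalent_space Y"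
    using hom deformation_retract_imp_homotopy_equivalent_space by blast
  then show ?thesis unfolding X_def Y_def .
qed

lemma complex_iso_sym:
  assumes "K \<cong>\<^sub>c L"
  shows "L \<cong>\<^sub>c K"
proof -
  obtain f where f: "bij_betw f (\<Union>K) (\<Union>L)" "\<And>\<sigma>. \<sigma> \<subseteq> \<Union>K \<Longrightarrow> \<sigma> \<in> K \<longleftrightarrow> f ` \<sigma> \<in> L"
    using assms unfolding complex_iso_def by blast
  let ?g = "inv_into (\<Union>K) f"
  have "\<tau> \<in> L \<longleftrightarrow> ?g ` \<tau> \<in> K" if \<tau>: "\<tau> \<subseteq> \<Union>L" for \<tau>
  proof -
    have im: "f ` \<Union>K = \<Union>L" using f(1) by (rule bij_betw_imp_surj_on)
    have "?g ` \<tau> \<subseteq> \<Union>K" by (rule image_subsetI) (metis \<tau> im inv_into_into subsetD)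
    moreover have "f ` ?g ` \<tau> = \<tau>" using image_inv_into_cancel[OF im \<tau>] .
    ultimately show ?thesis using f(2)[of "?g ` \<tau>"] by simp
  qed
  then show ?thesis
    unfolding complex_iso_def using bij_betw_inv_into[OF f(1)] by blast
qed

section \<open>Domination in the independence complex\<close>

context finite_graph begin

lemma abstract_complex_ind_complex: "abstract_complex ind_complex"
  unfolding abstract_complex_def ind_complex_def
  using finite_V finite_subset by blast

lemma Union_ind_complex: "\<Union>ind_complex = V"
proof -
  have "{v} \<in> ind_complex" if "v \<in> V" for v
    using that irrefl unfolding ind_complex_def by auto
  then have "V \<subseteq> \<Union>ind_complex" by blast
  moreover have "\<Union>ind_complex \<subseteq> V" unfolding ind_complex_def by blast
  ultimately show ?thesis by (rule subset_antisym[rotated])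
qed

text \<open>An independent set with \<open>v\<close> contains no neighbour of \<open>v\<close>,
  hence none of \<open>u\<close>, so \<open>u\<close> can be added and the link is a cone. Taking
  \<open>x = v\<close> in the hypothesis shows that \<open>u\<close> and \<open>v\<close> are not
  adjacent.\<close>

lemma dominated_ind_complex:
  assumes "u \<in> V" "v \<in> V" "u \<noteq> v" and N: "\<And>x. x \<in> V \<Longrightarrow> E u x \<Longrightarrow> E v x"
  shows "dominated ind_complex v"
proof -
  define B where "B = {\<sigma> \<in> link ind_complex v. u \<notin> \<sigma>}"
  have link: "\<sigma> \<in> link ind_complex v \<longleftrightarrow>
      \<sigma> \<subseteq> V \<and> v \<notin> \<sigma> \<and> (\<forall>x\<in>insert v \<sigma>. \<forall>y\<in>insert v \<sigma>. \<not> E x y)" for \<sigma>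
    using assms(2) unfolding link_def ind_complex_def by auto
  have "abstract_complex B"
    unfolding abstract_complex_def
  proof (intro conjI ballI allI impI)
    show "{} \<in> B" using irrefl by (simp add: B_def link)
    show "finite \<sigma>" if "\<sigma> \<in> B" for \<sigma>
      using that finite_V finite_subset by (auto simp: B_def link)
    show "\<tau> \<in> B" if "\<sigma> \<in> B" "\<tau> \<subseteq> \<sigma>" for \<sigma> \<tau>
      using that unfolding B_def link mem_Collect_eq by blast
  qed
  moreover have "u \<notin> \<Union>B" unfolding B_def by blast
  moreover have "link ind_complex v = B \<union> insert u ` B"
  proof (intro subset_antisym subsetI)
    fix \<sigma> assume \<sigma>: "\<sigma> \<in> link ind_complex v"
    show "\<sigma> \<in> B \<union> insert u ` B"
    proof (cases "u \<in> \<sigma>")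
      case True
      have "\<sigma> - {u} \<in> B" using \<sigma> unfolding B_def link mem_Collect_eq by blast
      moreover have "\<sigma> = insert u (\<sigma> - {u})" using True by blast
      ultimately show ?thesis by blast
    next
      case False
      then show ?thesis using \<sigma> unfolding B_def by blast
    qed
  next
    fix \<sigma> assume "\<sigma> \<in> B \<union> insert u ` B"
    then consider "\<sigma> \<in> link ind_complex v" | \<tau> where "\<sigma> = insert u \<tau>" "\<tau> \<in> link ind_complex v"
      unfolding B_def by blast
    then show "\<sigma> \<in> link ind_complex v"
    proof cases
      case (2 \<tau>)
      have \<tau>: "\<tau> \<subseteq> V" "v \<notin> \<tau>" "\<And>x y. x \<in> insert v \<tau> \<Longrightarrow> y \<in> insert v \<tau> \<Longrightarrow> \<not> E x y"
        using 2(2) unfolding link by auto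
      have u: "\<not> E u x" "\<not> E x u" if "x \<in> insert v \<tau>" for x
      proof -
        show "\<not> E u x" using that \<tau> N[of x] assms(2) by blast
        then show "\<not> E x u" using sym by blast
      qed
      have "\<not> E x y" if "x \<in> insert v (insert u \<tau>)" "y \<in> insert v (insert u \<tau>)" for x y
        using that u \<tau>(3) irrefl by blast
      then show ?thesis
        using 2(1) \<tau>(1,2) assms(1-3) unfolding link by simp
    qed
  qed
  ultimately have "cone_with_apex (link ind_complex v) u" unfolding cone_with_apex_def by blast
  then show ?thesis
    unfolding dominated_def dominated_by_def Union_ind_complex using assms by blast
qed

end

section \<open>Spherical complexes without dominated vertices\<close>

context chordal_graph begin

text \<open>Without dominated vertices no neighbourhood contains another, so simplicial vertices
  yield matched facets, and comparing these leaves each vertex one neighbour. A single matched facet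
  and its partners then exhaust \<open>V\<close> and label the matching.\<close>

lemma undominated_sphere_iso_matching:
  assumes undom: "\<And>u. \<not> dominated ind_complex u"
    and X: "geometric_realization ind_complex homotopy_equivalent_space nsphere n"
  shows "ind_complex \<cong>\<^sub>c independence_complex (matching_graph (Suc n))"
proof -
  have stiff: "\<exists>x\<in>V. E u x \<and> \<not> E v x" if "u \<in> V" "v \<in> V" "u \<noteq> v" for u v
    using dominated_ind_complex[OF that] undom by blast
  obtain h g where g: "continuous_map (nsphere n) (geometric_realization ind_complex) g"
    using X unfolding homotopy_equivalent_space_def by blast
  \<comment> \<open>The image of a point of the sphere is a point of the realization, so there is a
    vertex.\<close>
  have "g (\<lambda>i. if i = 0 then 1 else 0) \<in> topspace (geometric_realization ind_complex)"
    using g in_topspace_nsphere[of n] unfolding continuous_map_def by blast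
  then obtain x0 where x0: "x0 \<in> V"
    unfolding in_realization_iff by (metis equals0I sum.empty zero_neq_one)
  have nonisolated: "\<exists>v\<in>V. E u v" if u: "u \<in> V" for u
  proof (rule ccontr)
    assume "\<not> ?thesis"
    \<comment> \<open>The empty neighbourhood of \<open>u\<close> lies in every other one, so there
      is no other vertex; but a single point is contractible.\<close>
    then have V: "V = {u}" using stiff[OF u] u by blast
    have "x = (\<lambda>v. if v = u then 1 else 0)" if "x \<in> topspace (geometric_realization ind_complex)" for x
    proof
      fix v
      have "\<forall>v. v \<notin> V \<longrightarrow> x v = 0" "sum x V = 1" using that unfolding in_realization_iff by auto
      then show "x v = (if v = u then 1 else 0)" using V by simp
    qed
    then have "contractible_space (geometric_realization ind_complex)"
      by (intro contractible_space_subset_singleton[where a = "\<lambda>v. if v = u then 1 else 0"]) blast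
    then show False
      using homotopy_equivalent_space_contractibility[OF X] non_contractible_space_nsphere by blast
  qed
  have simplicial: "s = t"
    if z: "z \<in> V" "clique {v \<in> V. E z v}" and st: "s \<in> V" "t \<in> V" "E z s" "E z t" for z s t
  proof (rule ccontr)
    assume "s \<noteq> t"
    then have Est: "E s t" using z st unfolding clique_def by blast
    obtain F \<pi> where F: "matched_facet V F \<pi>" "s \<in> F" "\<pi> s = z"
      using simplicial_matched_facet[OF stiff z st(1,3)] .
    obtain H \<rho> where H: "matched_facet V H \<rho>" "t \<in> H" "\<rho> t = z"
      using simplicial_matched_facet[OF stiff z st(2,4)] .
    \<comment> \<open>Both neighbours are matched with \<open>z\<close>. In the second matching
      \<open>s\<close> would be a facet vertex or the partner of one other than \<open>t\<close>,
      and neither may be adjacent to \<open>t\<close>.\<close>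
    have "s \<in> H \<union> \<rho> ` H"
      using matched_facet_subset[OF F(1) _ H(1) _ X] F(2) H(2) by blast
    then show False
    proof
      assume "s \<in> H"
      then show False using matched_facetD(5)[OF H(1) _ H(2)] \<open>s \<noteq> t\<close> Est by blast
    next
      assume "s \<in> \<rho> ` H"
      then obtain w where w: "w \<in> H" "s = \<rho> w" by blast
      then have "w \<noteq> t" using H(3) st irrefl by metis
      then show False using matched_facetD(6)[OF H(1) w(1) H(2)] w Est by blast
    qed
  qed
  have uniq: "\<exists>y\<in>V. \<forall>v\<in>V. E x v \<longleftrightarrow> v = y" if "x \<in> V" for x
    by (rule unique_neighbour[OF stiff nonisolated simplicial that])
  obtain y0 where y0: "y0 \<in> V" "\<forall>v\<in>V. E x0 v \<longleftrightarrow> v = y0" using uniq[OF x0] by blast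
  then have "{v \<in> V. E x0 v} = {y0}" by (intro subset_antisym subsetI) auto
  then have cl: "clique {v \<in> V. E x0 v}" using y0(1) by (simp add: clique_def)
  have "E x0 y0" using y0 by blast
  obtain F \<pi> where F: "matched_facet V F \<pi>" "y0 \<in> F" "\<pi> y0 = x0"
    using simplicial_matched_facet[OF stiff x0 cl y0(1) \<open>E x0 y0\<close>] .
  have card: "card F = Suc n" using matched_facet_card[OF F(1) _ X] F(2) by blast
  then have "finite F" "F \<noteq> {}" by (auto intro: card_ge_0_finite)
  then obtain m e where "bij_betw e {..m} F" "card F = Suc m" using enum_exists by blast
  with card have e: "bij_betw e {..n} F" by simp
  note D = matched_facet_enum[OF F(1) e]
  define g where "g = (\<lambda>(i, b). if b then \<pi> (e i) else e i)"
  let ?M = "matching_graph (Suc n)"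
  have vM: "pverts ?M = {..n} \<times> UNIV" by (auto simp: matching_graph_def)
  have inj: "inj_on g (pverts ?M)"
    unfolding vM by (auto simp: inj_on_def g_def D D(4)[symmetric] split: if_splits)
  have im: "g ` pverts ?M = V"
  proof (intro subset_antisym subsetI)
    fix v assume "v \<in> g ` pverts ?M"
    then show "v \<in> V" unfolding vM using D(1,2) by (auto simp: g_def)
  next
    fix v assume v: "v \<in> V"
    have eF: "F = e ` {..n}" using bij_betw_imp_surj_on[OF e] by simp
    consider i where "i \<le> n" "v = e i" | i where "i \<le> n" "v = \<pi> (e i)"
    proof (cases "v \<in> F")
      case True
      then show thesis using that(1) eF by blast
    next
      case False
      \<comment> \<open>A vertex outside \<open>F\<close> sees some \<open>w\<close> in
        \<open>F\<close>, whose only neighbour is its partner.\<close>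
      then obtain w where w: "w \<in> F" "E w v"
        using matched_facetD(3)[OF F(1) v] unfolding dominates_def by blast
      then have "w \<in> V" "\<pi> w \<in> V" "E w (\<pi> w)" using matched_facetD(1,2,4)[OF F(1)] by auto
      then have "v = \<pi> w" using uniq[of w] v w by metis
      then show thesis using that(2) eF w by blast
    qed
    then show "v \<in> g ` pverts ?M"
    proof cases
      case (1 i) then show ?thesis unfolding vM by (intro image_eqI[of _ _ "(i, False)"]) (auto simp: g_def)
    next
      case (2 i) then show ?thesis unfolding vM by (intro image_eqI[of _ _ "(i, True)"]) (auto simp: g_def)
    qed
  qed
  have adj: "(p, q) \<in> parcs ?M \<longleftrightarrow> E (g p) (g q)" if "p \<in> pverts ?M" "q \<in> pverts ?M" for p q
  proof -
    obtain i a j b where "p = (i, a)" "q = (j, b)" "i \<le> n" "j \<le> n"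
      using \<open>p \<in> pverts ?M\<close> \<open>q \<in> pverts ?M\<close> unfolding vM by auto
    then show ?thesis
      using D(6-8)[of i j] D(7)[of j i] sym_iff[of "\<pi> (e i)"]
      by (auto simp: matching_graph_def g_def)
  qed
  have "\<sigma> \<in> independence_complex ?M \<longleftrightarrow> g ` \<sigma> \<in> ind_complex" if \<sigma>: "\<sigma> \<subseteq> pverts ?M" for \<sigma>
  proof -
    have "g ` \<sigma> \<subseteq> V" using im \<sigma> by blast
    moreover have "(\<forall>p\<in>\<sigma>. \<forall>q\<in>\<sigma>. (p, q) \<notin> parcs ?M) \<longleftrightarrow> (\<forall>p\<in>\<sigma>. \<forall>q\<in>\<sigma>. \<not> E (g p) (g q))"
      using adj \<sigma> by (meson subsetD)
    ultimately show ?thesis using \<sigma> unfolding independence_complex_def ind_complex_def by simp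
  qed
  then have "independence_complex ?M \<cong>\<^sub>c ind_complex"
    unfolding complex_iso_def Union_ind_complex
      pair_graph.independence_complex(2)[OF pair_graph_matching_graph]
    using inj im by (intro exI[of _ g]) (auto simp: bij_betw_def)
  then show ?thesis by (rule complex_iso_sym)
qed

end

theorem theorem4p1:
  fixes G :: "'a pair_pre_digraph" and k :: nat and C :: "'a set set"
  assumes "pair_graph G"
    and "chordal G"
    and "k \<ge> 1"
    and "geometric_realization (independence_complex G) homotopy_equivalent_space nsphere (k - 1)"
    and "is_core_of C (independence_complex G)"
  shows "C \<cong>\<^sub>c independence_complex (matching_graph k)"
proof -
  interpret pair_graph G by fact
  define E where "E = (\<lambda>u v. (u, v) \<in> parcs G)"
  \<comment> \<open>The vertex set is a parameter because it shrinks along the dismantling while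
    \<open>E\<close> stays fixed.\<close>
  define I where "I = (\<lambda>A. {\<sigma>. \<sigma> \<subseteq> A \<and> (\<forall>u\<in>\<sigma>. \<forall>v\<in>\<sigma>. \<not> E u v)})"
  have chordal_A: "chordal_graph A E" if A: "A \<subseteq> pverts G" for A
  proof
    show "finite A" using A pair_finite_verts finite_subset by blast
    show "E v u" if "E u v" for u v
      using that pair_sym_arcs unfolding E_def symmetric_def sym_def by simp
    show "\<not> E u u" for u using no_loops' unfolding E_def by blast
    fix vs assume vs: "length vs > 3" "distinct vs" "set vs \<subseteq> A"
    then have "\<not> induced_cycle G vs" using assms(2) unfolding chordal_def by blast
    then show "\<exists>i < length vs. \<exists>j < length vs.
        \<not> (E (vs ! i) (vs ! j) \<longleftrightarrow> j = Suc i mod length vs \<or> i = Suc j mod length vs)"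
      using vs A unfolding induced_cycle_def E_def by auto
  qed
  have I: "finite_graph.ind_complex A E = I A" if "A \<subseteq> pverts G" for A
  proof -
    interpret chordal_graph A E using chordal_A[OF that] .
    show ?thesis unfolding ind_complex_def I_def ..
  qed
  have "elementary_dismantling\<^sup>*\<^sup>* (independence_complex G) C"
    using assms(5) unfolding is_core_of_def by blast
  \<comment> \<open>The vertex set is carried along because chordality passes to induced subgraphs,
    the homotopy equivalence because the sphere is given for the initial complex.\<close>
  then have "\<exists>A\<subseteq>pverts G. C = I A \<and>
      geometric_realization (I A) homotopy_equivalent_space geometric_realization (independence_complex G)"
  proof (induction rule: rtranclp_induct)
    case base
    then show ?case
      by (intro exI[of _ "pverts G"])
        (auto simp: I_def E_def independence_complex_def homotopy_equivalent_space_refl)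
  next
    case (step K L)
    then obtain A u where A: "A \<subseteq> pverts G" "K = I A" "dominated K u" "L = remove_vertex K u"
      and hA: "geometric_realization (I A) homotopy_equivalent_space geometric_realization (independence_complex G)"
      unfolding elementary_dismantling_def by blast
    interpret chordal_graph A E using chordal_A[OF A(1)] .
    have L: "L = I (A - {u})" unfolding A(2,4) I_def remove_vertex_def by blast
    have "geometric_realization (I A) homotopy_equivalent_space geometric_realization L"
      using dominated_homotopy_equivalent[of "I A" u] abstract_complex_ind_complex A I by simp
    then have "geometric_realization L homotopy_equivalent_space geometric_realization (I A)"
      by (rule homotopy_equivalent_space_sym[THEN iffD1])
    then have "geometric_realization L homotopy_equivalent_space geometric_realization (independence_complex G)"
      using hA by (rule homotopy_eqv_trans)
    then show ?case using A(1) L by (intro exI[of _ "A - {u}"]) auto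
  qed
  then obtain A where A: "A \<subseteq> pverts G" "C = I A"
    and hA: "geometric_realization (I A) homotopy_equivalent_space geometric_realization (independence_complex G)"
    by blast
  have X: "geometric_realization (I A) homotopy_equivalent_space nsphere (k - 1)"
    using homotopy_eqv_trans[OF hA assms(4)] .
  interpret chordal_graph A E using chordal_A[OF A(1)] .
  have "\<not> dominated (I A) u" for u using assms(5) A(2) unfolding is_core_of_def by blast
  \<comment> \<open>As \<open>k\<close> is at least 1, \<open>Suc (k - 1)\<close> is
    \<open>k\<close>.\<close>
  then show ?thesis
    using undominated_sphere_iso_matching[of "k - 1"] X assms(3) A I by simp
qed

end
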